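(* There is an algorithm that, given any integer $k\geq 1$, any $e\in\{0,1,\ldots,k-1\}$ and any $x\in D_{2k}^e$, computes each of the Dyck paths $f(x),f^2(x),\ldots,f^{k-e}(x)$ in time $O(1)$ per path, using space $O(k)$, with overall running time including initialization $O(k)$.
   Context: A lattice path with $n$ steps is a sequence $x=(x_1,\ldots,x_n)$ of steps, each either an up-step $(1,1)$ or a down-step $(1,-1)$, drawn in $\mathbb{Z}^2$ starting at the origin; step $x_i$ goes from $(i-1,h_{i-1})$ to $(i,h_i)$, where $h_i$ is the height after $i$ steps. A step lies below the line $y=c$ if both of its endpoints have $y$-coordinate at most $c$. A step touches the line $y=c$ if it starts or ends on that line. For $c\in\mathbb{Z}$, $u_c(x)$ and $d_c(x)$ denote the number of up-steps, respectively down-steps, of $x$ that start on the line $y=c$. Let $L_{2k,k}$ (resp. $L_{2k,k+1}$) be the set of lattice paths with $2k$ steps of which exactly $k$ (resp. $k+1$) are up-steps. For $e\in\{0,\ldots,k\}$, $D_{2k}^e$ is the set of paths in $L_{2k,k}$ having exactly $e$ down-steps below the line $y=0$. For $x\in L_{2k,k}\setminus D_{2k}^k$, let $g(x)$ be obtained from $x$ by replacing by an up-step the $(d_0(x)+1)$-th (from the left) down-step of $x$ touching the line $y=0$. For $x'\in L_{2k,k+1}$, let $h(x')$ be obtained from $x'$ by replacing by a down-step the $u_1(x')$-th (from the left) up-step of $x'$ touching the line $y=1$. Define $f(x):=h(g(x))$; it maps $D_{2k}^e$ to $D_{2k}^{e+1}$ for $e<k$, and $f^i$ denotes its $i$-fold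 iterate. Paths are stored as arrays of length $2k$, and computing the next path means updating the current one. *)

theory Defs
  imports Main
begin

section \<open>Lattice paths\<close>

datatype step = Up | Down

primrec rise :: "step \<Rightarrow> int" where
  "rise Up = 1"
| "rise Down = - 1"

type_synonym path = "step list"

text \<open>
  Steps are numbered from 0, so step \<open>i\<close> goes from height \<open>height x i\<close> to height
  \<open>height x (Suc i)\<close>.
\<close>

definition height :: "path \<Rightarrow> nat \<Rightarrow> int" where
  "height x i = sum_list (map rise (take i x))"

definition below :: "path \<Rightarrow> int \<Rightarrow> nat \<Rightarrow> bool" where
  "below x c i \<longleftrightarrow> height x i \<le> c \<and> height x (Suc i) \<le> c"

definition touches :: "path \<Rightarrow> int \<Rightarrow> nat \<Rightarrow> bool" where
  "touches x c i \<longleftrightarrow> height x i = c \<or> height x (Suc i) = c"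

definition u :: "int \<Rightarrow> path \<Rightarrow> nat" where
  "u c x = card {i. i < length x \<and> x ! i = Up \<and> height x i = c}"

definition d :: "int \<Rightarrow> path \<Rightarrow> nat" where
  "d c x = card {i. i < length x \<and> x ! i = Down \<and> height x i = c}"

definition L :: "nat \<Rightarrow> nat \<Rightarrow> path set" where
  "L n m = {x. length x = n \<and> card {i. i < length x \<and> x ! i = Up} = m}"

text \<open>\<open>D k e\<close> consists of paths with \<open>2 * k\<close> steps.\<close>

definition D :: "nat \<Rightarrow> nat \<Rightarrow> path set" where
  "D k e = {x \<in> L (2 * k) k. card {i. i < length x \<and> x ! i = Down \<and> below x 0 i} = e}"

definition touching_steps :: "step \<Rightarrow> int \<Rightarrow> path \<Rightarrow> nat list" where
  "touching_steps a c x = filter (\<lambda>i. x ! i = a \<and> touches x c i) [0..<length x]"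

text \<open>
  The \<open>j\<close>-th element of a list is \<open>xs ! (j - 1)\<close>. The functions below are only meaningful on
  \<open>L (2 * k) k - D k k\<close> (\<open>g\<close> and \<open>f\<close>) and on \<open>L (2 * k) (k + 1)\<close> (\<open>h\<close>).
\<close>

definition g :: "path \<Rightarrow> path" where
  "g x = x[touching_steps Down 0 x ! ((d 0 x + 1) - 1) := Up]"

definition h :: "path \<Rightarrow> path" where
  "h x = x[touching_steps Up 1 x ! (u 1 x - 1) := Down]"

definition f :: "path \<Rightarrow> path" where
  "f x = h (g x)"


section \<open>Model of computation\<close>

text \<open>
  A random access machine with structured control flow. It has a memory of \<open>N\<close> cells, addressed
  from 0 to \<open>N - 1\<close>, and registers, of which every program uses a fixed finite number. The parameter
  \<open>N\<close> also bounds the absolute value of every number that can be computed, so that words have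
  \<open>O(log N)\<close> bits. A program that accesses an address outside the memory or exceeds
  the word bound gets stuck, so that it has no execution. Hence an execution on the machine with
  parameter \<open>N\<close> uses space \<open>O(N)\<close>.
\<close>

type_synonym reg = nat

record state =
  regs :: "reg \<Rightarrow> int"
  mem :: "nat \<Rightarrow> int"

datatype instr =
    Const reg int
  | Add reg reg reg
  | Sub reg reg reg
  | Load reg reg
  | Store reg reg
  | Emit

datatype com =
    Skip
  | Do instr
  | Seq com com
  | If reg reg com com
  | While reg reg com

text \<open>
  Every executed instruction and every evaluated test takes one time unit and produces exactly one
  event, so that the running time is the length of the event sequence (\<open>Skip\<close> is free). \<open>Emit\<close> announces
  that the memory now holds the next object to be computed.
\<close>

datatype event = Tick | Visit "nat \<Rightarrow> int"

definition set_reg :: "nat \<Rightarrow> reg \<Rightarrow> int \<Rightarrow> state \<Rightarrow> (event \<times> state) option" where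
  "set_reg N r v s =
    (if \<bar>v\<bar> \<le> int N then Some (Tick, s\<lparr>regs := (regs s)(r := v)\<rparr>) else None)"

definition valid_address :: "nat \<Rightarrow> int \<Rightarrow> bool" where
  "valid_address N a \<longleftrightarrow> 0 \<le> a \<and> a < int N"

fun exec_instr :: "nat \<Rightarrow> instr \<Rightarrow> state \<Rightarrow> (event \<times> state) option" where
  "exec_instr N (Const r c) s = set_reg N r c s"
| "exec_instr N (Add r a b) s = set_reg N r (regs s a + regs s b) s"
| "exec_instr N (Sub r a b) s = set_reg N r (regs s a - regs s b) s"
| "exec_instr N (Load r a) s =
    (if valid_address N (regs s a) then set_reg N r (mem s (nat (regs s a))) s else None)"
| "exec_instr N (Store a r) s =
    (if valid_address N (regs s a)
     then Some (Tick, s\<lparr>mem := (mem s)(nat (regs s a) := regs s r)\<rparr>) else None)"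
| "exec_instr N Emit s = Some (Visit (mem s), s)"

text \<open>The test of \<open>If a b\<close> and \<open>While a b\<close> is that register \<open>a\<close> is smaller than register \<open>b\<close>.\<close>

inductive exec :: "nat \<Rightarrow> com \<Rightarrow> state \<Rightarrow> event list \<Rightarrow> state \<Rightarrow> bool" for N where
  Skip: "exec N Skip s [] s"
| Do: "exec_instr N i s = Some (ev, s') \<Longrightarrow> exec N (Do i) s [ev] s'"
| Seq: "exec N c1 s tr1 s' \<Longrightarrow> exec N c2 s' tr2 s'' \<Longrightarrow> exec N (Seq c1 c2) s (tr1 @ tr2) s''"
| IfTrue: "regs s a < regs s b \<Longrightarrow> exec N c1 s tr s' \<Longrightarrow> exec N (If a b c1 c2) s (Tick # tr) s'"
| IfFalse: "\<not> regs s a < regs s b \<Longrightarrow> exec N c2 s tr s' \<Longrightarrow> exec N (If a b c1 c2) s (Tick # tr) s'"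
| WhileFalse: "\<not> regs s a < regs s b \<Longrightarrow> exec N (While a b c) s [Tick] s"
| WhileTrue: "regs s a < regs s b \<Longrightarrow> exec N c s tr1 s' \<Longrightarrow> exec N (While a b c) s' tr2 s'' \<Longrightarrow>
    exec N (While a b c) s (Tick # tr1 @ tr2) s''"

inductive_cases exec_SkipE: "exec N Skip s tr s'"
inductive_cases exec_DoE: "exec N (Do i) s tr s'"
inductive_cases exec_SeqE: "exec N (Seq c1 c2) s tr s'"
inductive_cases exec_IfE: "exec N (If a b c1 c2) s tr s'"
inductive_cases exec_WhileE: "exec N (While a b c) s tr s'"

lemma exec_deterministic:
  "exec N c s tr s' \<Longrightarrow> exec N c s tr' s'' \<Longrightarrow> tr' = tr \<and> s'' = s'"
proof (induction arbitrary: tr' s'' rule: exec.induct)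
  case Skip
  then show ?case by (auto elim: exec_SkipE)
next
  case Do
  then show ?case by (auto elim: exec_DoE)
next
  case Seq
  then show ?case by (blast elim: exec_SeqE)
next
  case IfTrue
  then show ?case by (blast elim: exec_IfE)
next
  case IfFalse
  then show ?case by (blast elim: exec_IfE)
next
  case WhileFalse
  then show ?case by (blast elim: exec_WhileE)
next
  case WhileTrue
  from WhileTrue.prems show ?case
    by (rule exec_WhileE) (use WhileTrue.hyps(1) WhileTrue.IH in blast)+
qed

text \<open>
  The path is stored in the cells \<open>0, \<dots>, length x - 1\<close>, with \<open>1\<close> for an up-step and \<open>-1\<close> for a
  down-step. Initially, registers 0 and 1 hold \<open>k\<close> and \<open>e\<close>, and all other registers and cells hold 0.
\<close>

definition stores_path :: "(nat \<Rightarrow> int) \<Rightarrow> path \<Rightarrow> bool" where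
  "stores_path m x \<longleftrightarrow> (\<forall>i < length x. m i = rise (x ! i))"

definition input_state :: "nat \<Rightarrow> nat \<Rightarrow> path \<Rightarrow> state" where
  "input_state k e x =
    \<lparr>regs = (\<lambda>_. 0)(0 := int k, 1 := int e),
     mem = (\<lambda>i. if i < length x then rise (x ! i) else 0)\<rparr>"

end

(*
Cut x at its returns to height 0 into excursions, and let A consist of the first d_0(x) of them and B
of the others. Then A has as many positive excursions as B has negative ones, and matching these like
nested brackets turns x into a Dyck path w: a positive excursion U c D becomes U c U in A, a negative
excursion D c' U becomes D c D in B, where c' is the complement of c, negative excursions in A are
complemented and positive ones in B are kept. This w does not change when f is applied. So if a is the
boundary between A and B, both flipped positions and the next boundary can be read off the matching
of the steps of w: with m the partner of a position, p = max a (m a) is flipped to an up-step, then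
p' = min q (m q) to a down-step, where q is a neighbour of p or of m p, and the new boundary is a
neighbour of p' or of m p', depending on parities. Two scans of x with a stack tabulate the matching
in time O(k), and afterwards every path costs a constant number of table lookups.
*)

theory Submission
  imports Defs
begin

section \<open>Dyck paths\<close>

text \<open>Why \<open>w\<close> survives: A has as many positive excursions as B has negative ones,
  and these two numbers cancel in the count \<open>u_1\<close> of the path \<open>g x\<close>. Hence
  \<open>h\<close> always acts on one excursion near the boundary: the first of B if it is positive,
  otherwise its bracket partner, the last positive one of A. If its inside is
  \<open>c1 U c2 D\<close>, it is cut open there: \<open>U c1 D\<close> goes to A, the excursions of
  \<open>c2\<close> go to B, and a larger or new negative excursion follows them in B. If the inside
  is empty, a negative excursion joins A instead. Old and new blocks spell the same piece of
  \<open>w\<close>. The obstacle is that each flip shifts all later heights and so changes which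
  steps touch a line. As \<open>w\<close> stays fixed, its tables are never updated. Parity can
  choose the neighbour because excursions have even length, so boundaries are even: \<open>p\<close>
  is odd when it closes a positive excursion and even when it opens a negative one. Two scans are
  needed since the rule producing \<open>w\<close> depends on the side of the boundary, which is
  known only once \<open>d_0\<close> has been counted.\<close>

fun flip :: "step \<Rightarrow> step" where
  "flip Up = Down"
| "flip Down = Up"

lemma flip_flip [simp]: "flip (flip s) = s"
  by (cases s) auto

lemma rise_flip [simp]: "rise (flip s) = - rise s"
  by (cases s) auto

abbreviation compl :: "path \<Rightarrow> path" where
  "compl \<equiv> map flip"

definition net :: "path \<Rightarrow> int" where
  "net x = sum_list (map rise x)"

lemma net_simps [simp]:
  "net [] = 0" "net (s # x) = rise s + net x" "net (x @ y) = net x + net y"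
  by (auto simp: net_def)

lemma net_compl [simp]: "net (compl x) = - net x"
  by (induction x) auto

lemma height_0 [simp]: "height x 0 = 0"
  by (simp add: height_def)

lemma height_length [simp]: "height x (length x) = net x"
  by (simp add: height_def net_def)

lemma height_append1: "i \<le> length x \<Longrightarrow> height (x @ y) i = height x i"
  by (simp add: height_def)

lemma height_append2: "height (x @ y) (length x + i) = net x + height y i"
  by (simp add: height_def net_def)

lemma height_Suc: "i < length x \<Longrightarrow> height x (Suc i) = height x i + rise (x ! i)"
  by (simp add: height_def take_Suc_conv_app_nth)

lemma height_Cons [simp]: "height (s # x) (Suc i) = rise s + height x i"
  by (simp add: height_def)

lemma rise_cases: "rise s = 1 \<or> rise s = - 1"
  by (cases s) auto

lemma abs_height: "\<bar>height x i\<bar> \<le> int i"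
proof (induction x arbitrary: i)
  case Nil
  then show ?case by (simp add: height_def)
next
  case (Cons s x)
  show ?case
  proof (cases i)
    case (Suc j)
    then show ?thesis using Cons.IH[of j] rise_cases[of s] by auto
  qed simp
qed

inductive dyck :: "path \<Rightarrow> bool" where
  Nil: "dyck []"
| Cons: "dyck a \<Longrightarrow> dyck b \<Longrightarrow> dyck (Up # a @ Down # b)"

lemma dyck_append: "dyck a \<Longrightarrow> dyck b \<Longrightarrow> dyck (a @ b)"
  by (induction rule: dyck.induct) (auto intro: dyck.Cons)

lemma dyck_wrap: "dyck a \<Longrightarrow> dyck (Up # a @ [Down])"
  using dyck.Cons[OF _ dyck.Nil] by simp

lemma dyck_net: "dyck a \<Longrightarrow> net a = 0"
  by (induction rule: dyck.induct) auto

lemma dyck_even: "dyck a \<Longrightarrow> even (length a)"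
  by (induction rule: dyck.induct) auto

text \<open>The last-return decomposition. \<open>h\<close> flips the opening step of the last piece
  \<open>Up # b @ [Down]\<close> inside an excursion, so \<open>layout_step\<close> cuts
  there.\<close>

lemma dyck_snoc_cases:
  assumes "dyck w"
  obtains "w = []" | a b where "dyck a" "dyck b" "w = a @ Up # b @ [Down]"
proof -
  from assms have "w = [] \<or> (\<exists>a b. dyck a \<and> dyck b \<and> w = a @ Up # b @ [Down])"
  proof (induction rule: dyck.induct)
    case (Cons a b)
    from Cons.IH(2) show ?case
    proof
      assume "b = []"
      then show ?thesis
        using Cons.hyps by (intro disjI2 exI[of _ "[]"] exI[of _ a]) (auto intro: dyck.Nil)
    next
      assume "\<exists>a' b'. dyck a' \<and> dyck b' \<and> b = a' @ Up # b' @ [Down]"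
      then obtain a' b' where "dyck a'" "dyck b'" "b = a' @ Up # b' @ [Down]" by blast
      then show ?thesis
        using Cons.hyps by (intro disjI2 exI[of _ "Up # a @ Down # a'"] exI[of _ b']) (auto intro: dyck.Cons)
    qed
  qed simp
  with that show thesis by blast
qed

lemma dyck_height_nonneg: "dyck w \<Longrightarrow> i \<le> length w \<Longrightarrow> 0 \<le> height w i"
proof (induction arbitrary: i rule: dyck.induct)
  case (Cons a b)
  consider "i = 0" | j where "i = Suc j" "j \<le> length a" | j where "i = Suc (Suc (length a + j))" "j \<le> length b"
  proof (cases i)
    case (Suc j)
    show thesis
    proof (cases "j \<le> length a")
      case False
      then have "i = Suc (Suc (length a + (j - Suc (length a))))" "j - Suc (length a) \<le> length b"
        using Suc Cons.prems by auto
      with that(3) show thesis .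
    qed (use Suc that in auto)
  qed (use that in auto)
  then show ?case
  proof cases
    case (2 j)
    then show ?thesis using Cons.IH(1)[of j] by (simp add: height_append1)
  next
    case (3 j)
    then show ?thesis
      using Cons.IH(2)[of j] height_append2[of a "Down # b" "Suc j"] dyck_net[OF Cons.hyps(1)] by simp
  qed simp
qed (simp add: height_def)

lemma first_passage_below:
  assumes "net x < 0"
  obtains c r where "dyck c" "x = c @ Down # r"
proof -
  from assms have "\<exists>c r. dyck c \<and> x = c @ Down # r"
  proof (induction "length x" arbitrary: x rule: less_induct)
    case less
    show ?case
    proof (cases x)
      case Nil
      with less.prems show ?thesis by simp
    next
      case (Cons s y)
      show ?thesis
      proof (cases s)
        case Down
        then show ?thesis using Cons dyck.Nil by (intro exI[of _ "[]"] exI[of _ y]) auto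
      next
        \<comment> \<open>After an initial \<open>Up\<close> the rest must fall by two, so the
          induction hypothesis is used twice: once to get back to the starting level, once to leave
          it downwards.\<close>
        case Up
        obtain c r where c: "dyck c" "y = c @ Down # r"
          using less.hyps[of y] less.prems Cons Up by auto
        moreover obtain c' r' where "dyck c'" "r = c' @ Down # r'"
          using less.hyps[of r] less.prems Cons Up c dyck_net[OF c(1)] by auto
        ultimately show ?thesis
          using Cons Up by (intro exI[of _ "Up # c @ Down # c'"] exI[of _ r']) (auto intro: dyck.Cons)
      qed
    qed
  qed
  with that show thesis by blast
qed

section \<open>Positions of distinguished steps\<close>

text \<open>\<open>P\<close> receives the height at which a step starts, and the step; the path starts at height \<open>c\<close>.\<close>

primrec pos :: "(int \<Rightarrow> step \<Rightarrow> bool) \<Rightarrow> int \<Rightarrow> path \<Rightarrow> nat list" where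
  "pos P c [] = []"
| "pos P c (s # x) = (if P c s then [0] else []) @ map Suc (pos P (c + rise s) x)"

lemma pos_append: "pos P c (x @ y) = pos P c x @ map ((+) (length x)) (pos P (c + net x) y)"
proof (induction x arbitrary: c)
  case Nil
  have "(+) (0 :: nat) = id" by auto
  then show ?case by simp
qed (auto simp: comp_def add.assoc)

lemma pos_eq_filter: "pos P c x = filter (\<lambda>i. P (c + height x i) (x ! i)) [0..<length x]"
proof (induction x arbitrary: c)
  case (Cons s x)
  have *: "[0..<length (s # x)] = 0 # map Suc [0..<length x]"
    by (simp add: upt_conv_Cons map_Suc_upt del: upt_Suc)
  show ?case
    unfolding * by (simp add: Cons.IH filter_map comp_def add.assoc)
qed simp

lemma length_pos: "length (pos P 0 x) = card {i. i < length x \<and> P (height x i) (x ! i)}"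
proof -
  have "card {i. i < length x \<and> P (height x i) (x ! i)} = card (set (pos P 0 x))"
    by (rule arg_cong[of _ _ card]) (auto simp: pos_eq_filter)
  also have "\<dots> = length (pos P 0 x)"
    by (rule distinct_card) (simp add: pos_eq_filter)
  finally show ?thesis by simp
qed

text \<open>A Dyck path started at height \<open>c\<close> has only steps with both ends at
  \<open>c\<close> or higher, so other values of \<open>P\<close> are invisible. With
  \<open>Q\<close> constantly false this removes the insides of excursions from the counts
  below.\<close>

lemma pos_dyck_cong:
  assumes "dyck w" "\<And>b s. c \<le> b \<Longrightarrow> c \<le> b + rise s \<Longrightarrow> P b s = Q b s"
  shows "pos P c w = pos Q c w"
  using assms
proof (induction arbitrary: c rule: dyck.induct)
  case (Cons a b)
  have "pos P (c + 1) a = pos Q (c + 1) a" by (rule Cons.IH) (use Cons.prems in auto)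
  moreover have "pos P c b = pos Q c b" by (rule Cons.IH) (use Cons.prems in auto)
  ultimately show ?case
    using Cons.prems[of c Up] Cons.prems[of "c + 1" Down] dyck_net[OF Cons.hyps(1)]
    by (simp add: pos_append)
qed simp

lemma pos_compl_dyck_cong:
  assumes "dyck w" "\<And>b s. b \<le> c \<Longrightarrow> b + rise s \<le> c \<Longrightarrow> P b s = Q b s"
  shows "pos P c (compl w) = pos Q c (compl w)"
  using assms
proof (induction arbitrary: c rule: dyck.induct)
  case (Cons a b)
  have "pos P (c - 1) (compl a) = pos Q (c - 1) (compl a)" by (rule Cons.IH) (use Cons.prems in auto)
  moreover have "pos P c (compl b) = pos Q c (compl b)" by (rule Cons.IH) (use Cons.prems in auto)
  ultimately show ?case
    using Cons.prems[of c Down] Cons.prems[of "c - 1" Up] dyck_net[OF Cons.hyps(1)]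
    by (simp add: pos_append)
qed simp

lemma pos_False [simp]: "pos (\<lambda>_ _. False) c x = []"
  by (induction x arbitrary: c) auto

lemma pos_dyck_empty:
  "dyck w \<Longrightarrow> (\<And>b s. c \<le> b \<Longrightarrow> c \<le> b + rise s \<Longrightarrow> \<not> P b s) \<Longrightarrow> pos P c w = []"
  using pos_dyck_cong[of w c P "\<lambda>_ _. False"] by simp

lemma pos_compl_dyck_empty:
  "dyck w \<Longrightarrow> (\<And>b s. b \<le> c \<Longrightarrow> b + rise s \<le> c \<Longrightarrow> \<not> P b s) \<Longrightarrow> pos P c (compl w) = []"
  using pos_compl_dyck_cong[of w c P "\<lambda>_ _. False"] by simp

definition touching :: "step \<Rightarrow> int \<Rightarrow> int \<Rightarrow> step \<Rightarrow> bool" where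
  "touching a c b s \<longleftrightarrow> s = a \<and> (b = c \<or> b + rise s = c)"

definition starting :: "step \<Rightarrow> int \<Rightarrow> int \<Rightarrow> step \<Rightarrow> bool" where
  "starting a c b s \<longleftrightarrow> s = a \<and> b = c"

text \<open>A down-step from height at most 0 ends even lower, hence the one-sided test.\<close>

definition sunken :: "int \<Rightarrow> step \<Rightarrow> bool" where
  "sunken b s \<longleftrightarrow> s = Down \<and> b \<le> 0"

definition returning :: "int \<Rightarrow> step \<Rightarrow> bool" where
  "returning b s \<longleftrightarrow> b + rise s = 0"

lemma touching_steps_pos: "touching_steps a c x = pos (touching a c) 0 x"
  unfolding touching_steps_def pos_eq_filter
  by (rule filter_cong) (auto simp: touches_def touching_def height_Suc)

lemma u_pos: "u c x = length (pos (starting Up c) 0 x)"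
  by (auto simp: u_def length_pos starting_def)

lemma d_pos: "d c x = length (pos (starting Down c) 0 x)"
  by (auto simp: d_def length_pos starting_def)

lemma below_pos: "card {i. i < length x \<and> x ! i = Down \<and> below x 0 i} = length (pos sunken 0 x)"
  unfolding length_pos by (rule arg_cong[of _ _ card]) (auto simp: below_def sunken_def height_Suc)

section \<open>Excursions\<close>

text \<open>\<open>(True, c)\<close> is an excursion above, and \<open>(False, c)\<close> one below the starting height.\<close>

type_synonym block = "bool \<times> path"

text \<open>The inside of a negative excursion is stored complemented: \<open>snd\<close> is a Dyck
  path for both signs, and \<open>w\<close> contains it unchanged.\<close>

fun blk :: "block \<Rightarrow> path" where
  "blk (True, c) = Up # c @ [Down]"
| "blk (False, c) = Down # compl c @ [Up]"

abbreviation blks :: "block list \<Rightarrow> path" where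
  "blks bs \<equiv> concat (map blk bs)"

text \<open>Every excursion has exactly one down-step touching height 0: the closing step of a
  positive one, the opening step of a negative one.\<close>

fun down_offset :: "block \<Rightarrow> nat" where
  "down_offset (True, c) = Suc (length c)"
| "down_offset (False, c) = 0"

definition valid :: "block list \<Rightarrow> bool" where
  "valid bs \<longleftrightarrow> (\<forall>b \<in> set bs. dyck (snd b))"

lemma valid_simps [simp]:
  "valid []" "valid (b # bs) \<longleftrightarrow> dyck (snd b) \<and> valid bs" "valid (as @ bs) \<longleftrightarrow> valid as \<and> valid bs"
  by (auto simp: valid_def)

definition npos :: "block list \<Rightarrow> nat" where
  "npos bs = length (filter fst bs)"

definition nneg :: "block list \<Rightarrow> nat" where
  "nneg bs = length (filter (\<lambda>b. \<not> fst b) bs)"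

lemma npos_simps [simp]:
  "npos [] = 0" "npos (b # bs) = (if fst b then 1 else 0) + npos bs" "npos (as @ bs) = npos as + npos bs"
  by (auto simp: npos_def)

lemma nneg_simps [simp]:
  "nneg [] = 0" "nneg (b # bs) = (if fst b then 0 else 1) + nneg bs" "nneg (as @ bs) = nneg as + nneg bs"
  by (auto simp: nneg_def)

lemma npos_plus_nneg: "npos bs + nneg bs = length bs"
  by (induction bs) auto

text \<open>Twice the number of flaws, by \<open>length_pos_sunken\<close>.\<close>

definition below_length :: "block list \<Rightarrow> nat" where
  "below_length bs = sum_list (map (\<lambda>b. if fst b then 0 else length (blk b)) bs)"

lemma below_length_simps [simp]:
  "below_length [] = 0"
  "below_length (b # bs) = (if fst b then 0 else length (blk b)) + below_length bs"
  "below_length (as @ bs) = below_length as + below_length bs"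
  by (auto simp: below_length_def)

lemma net_blk [simp]: "dyck (snd b) \<Longrightarrow> net (blk b) = 0"
  by (cases b rule: blk.cases) (auto dest: dyck_net)

lemma net_blks [simp]: "valid bs \<Longrightarrow> net (blks bs) = 0"
  by (induction bs) auto

lemma even_blk: "dyck (snd b) \<Longrightarrow> even (length (blk b))"
  by (cases b rule: blk.cases) (auto dest: dyck_even)

lemma even_blks: "valid bs \<Longrightarrow> even (length (blks bs))"
  by (induction bs) (auto simp: even_blk)

lemma pos_touching_down_blk:
  "dyck (snd b) \<Longrightarrow> pos (touching Down 0) 0 (blk b) = [down_offset b]"
proof (cases b rule: blk.cases)
  case (1 c)
  assume "dyck (snd b)"
  then have "pos (touching Down 0) 1 c = []" "net c = 0"
    using 1 by (auto intro!: pos_dyck_empty simp: touching_def dyck_net)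
  then show ?thesis using 1 by (simp add: pos_append touching_def)
next
  case (2 c)
  assume "dyck (snd b)"
  then have "pos (touching Down 0) (- 1) (compl c) = []" "net c = 0"
    using 2 by (auto intro!: pos_compl_dyck_empty simp: touching_def dyck_net)
  then show ?thesis using 2 by (simp add: pos_append touching_def)
qed

lemma length_pos_touching_down:
  "valid bs \<Longrightarrow> length (pos (touching Down 0) 0 (blks bs)) = length bs"
  by (induction bs) (simp_all add: pos_append pos_touching_down_blk)

lemma length_pos_starting_down:
  "valid bs \<Longrightarrow> length (pos (starting Down 0) 0 (blks bs)) = nneg bs"
proof (induction bs)
  case (Cons b bs)
  then have d: "dyck (snd b)" by simp
  have "length (pos (starting Down 0) 0 (blk b)) = (if fst b then 0 else 1)"
  proof (cases b rule: blk.cases)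
    case (1 c)
    then have "pos (starting Down 0) 1 c = []" "net c = 0"
      using d by (auto intro!: pos_dyck_empty simp: starting_def dyck_net)
    then show ?thesis using 1 by (simp add: pos_append starting_def)
  next
    case (2 c)
    then have "pos (starting Down 0) (- 1) (compl c) = []" "net c = 0"
      using d by (auto intro!: pos_compl_dyck_empty simp: starting_def dyck_net)
    then show ?thesis using 2 by (simp add: pos_append starting_def)
  qed
  with Cons d show ?case by (simp add: pos_append)
qed simp

lemma length_pos_returning:
  "valid bs \<Longrightarrow> length (pos returning 0 (blks bs)) = length bs"
proof (induction bs)
  case (Cons b bs)
  then have d: "dyck (snd b)" by simp
  have "length (pos returning 0 (blk b)) = 1"
  proof (cases b rule: blk.cases)
    case (1 c)
    then have "pos returning 1 c = []" "net c = 0"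
      using d by (auto intro!: pos_dyck_empty simp: returning_def dyck_net)
    then show ?thesis using 1 by (simp add: pos_append returning_def)
  next
    case (2 c)
    then have "pos returning (- 1) (compl c) = []" "net c = 0"
      using d by (auto intro!: pos_compl_dyck_empty simp: returning_def dyck_net)
    then show ?thesis using 2 by (simp add: pos_append returning_def)
  qed
  with Cons d show ?case by (simp add: pos_append)
qed simp

lemma length_pos_sunken_compl:
  "dyck w \<Longrightarrow> c \<le> 0 \<Longrightarrow> 2 * length (pos sunken c (compl w)) = length w"
proof (induction arbitrary: c rule: dyck.induct)
  case (Cons a b)
  have "2 * length (pos sunken (c - 1) (compl a)) = length a"
    "2 * length (pos sunken c (compl b)) = length b"
    using Cons by auto
  moreover have "sunken c Down" "\<not> sunken (c - 1) Up"
    using Cons.prems by (auto simp: sunken_def)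
  ultimately show ?case
    using dyck_net[OF Cons.hyps(1)] by (simp add: pos_append)
qed simp

lemma length_pos_sunken:
  "valid bs \<Longrightarrow> 2 * length (pos sunken 0 (blks bs)) = below_length bs"
proof (induction bs)
  case (Cons b bs)
  then have d: "dyck (snd b)" by simp
  have "2 * length (pos sunken 0 (blk b)) = (if fst b then 0 else length (blk b))"
  proof (cases b rule: blk.cases)
    case (1 c)
    then have "pos sunken 1 c = []" "net c = 0"
      using d by (auto intro!: pos_dyck_empty simp: sunken_def dyck_net)
    then show ?thesis using 1 by (simp add: pos_append sunken_def)
  next
    case (2 c)
    then have "2 * length (pos sunken (- 1) (compl c)) = length c" "net c = 0"
      using d by (auto intro!: length_pos_sunken_compl simp: dyck_net)
    then show ?thesis using 2 by (simp add: pos_append sunken_def)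
  qed
  with Cons d show ?case by (simp add: pos_append distrib_left)
qed simp

lemma balanced_blocks:
  assumes "net x = 0"
  obtains bs where "valid bs" "x = blks bs"
proof -
  from assms have "\<exists>bs. valid bs \<and> x = blks bs"
  proof (induction "length x" arbitrary: x rule: less_induct)
    case less
    show ?case
    proof (cases x)
      case Nil
      then show ?thesis by (intro exI[of _ "[]"]) auto
    next
      case (Cons s y)
      show ?thesis
      proof (cases s)
        case Up
        then obtain c r where c: "dyck c" "y = c @ Down # r"
          using less.prems Cons first_passage_below[of y] by auto
        moreover obtain bs where "valid bs" "r = blks bs"
          using less.hyps[of r] less.prems Cons Up c dyck_net[OF c(1)] by auto
        ultimately show ?thesis
          using Cons Up by (intro exI[of _ "(True, c) # bs"]) auto
      next
        case Down
        then have "net (compl y) < 0" using less.prems Cons by simp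
        then obtain c r where c: "dyck c" "compl y = c @ Down # r"
          using first_passage_below by blast
        have "y = compl (compl y)" by (simp add: comp_def)
        also have "\<dots> = compl c @ Up # compl r" by (simp add: c)
        finally have y: "y = compl c @ Up # compl r" .
        obtain bs where "valid bs" "compl r = blks bs"
          using less.hyps[of "compl r"] less.prems Cons Down y dyck_net[OF c(1)] by auto
        with c y show ?thesis
          using Cons Down by (intro exI[of _ "(False, c) # bs"]) auto
      qed
    qed
  qed
  with that show thesis by blast
qed

text \<open>When \<open>f\<close> cuts an excursion open, the part \<open>c2\<close> comes to lie at
  height 0 and must be listed as excursions of its own.\<close>

lemma dyck_blocks:
  assumes "dyck w"
  obtains bs where "valid bs" "w = blks bs" "nneg bs = 0"
proof -
  from assms have "\<exists>bs. valid bs \<and> w = blks bs \<and> nneg bs = 0"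
  proof (induction rule: dyck.induct)
    case (Cons a b)
    then obtain bs where "valid bs" "b = blks bs" "nneg bs = 0" by auto
    with Cons.hyps show ?case by (intro exI[of _ "(True, a) # bs"]) auto
  qed (auto intro: exI[of _ "[]"])
  with that show thesis by blast
qed

section \<open>The invariant Dyck path\<close>

fun left_blk :: "block \<Rightarrow> path" where
  "left_blk (True, c) = Up # c @ [Up]"
| "left_blk (False, c) = Up # c @ [Down]"

fun right_blk :: "block \<Rightarrow> path" where
  "right_blk (True, c) = Up # c @ [Down]"
| "right_blk (False, c) = Down # c @ [Down]"

abbreviation lefts :: "block list \<Rightarrow> path" where
  "lefts bs \<equiv> concat (map left_blk bs)"

abbreviation rights :: "block list \<Rightarrow> path" where
  "rights bs \<equiv> concat (map right_blk bs)"

lemma length_left_blk [simp]: "length (left_blk b) = length (blk b)"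
  by (cases b rule: blk.cases) auto

lemma length_right_blk [simp]: "length (right_blk b) = length (blk b)"
  by (cases b rule: blk.cases) auto

lemma length_lefts [simp]: "length (lefts bs) = length (blks bs)"
  by (induction bs) auto

lemma length_rights [simp]: "length (rights bs) = length (blks bs)"
  by (induction bs) auto

text \<open>Needed when the negative excursions at the end of A are swallowed by a larger negative
  excursion.\<close>

lemma compl_lefts: "npos bs = 0 \<Longrightarrow> compl (lefts bs) = blks bs"
proof (induction bs)
  case (Cons b bs)
  then show ?case by (cases b rule: blk.cases) auto
qed simp

lemma dyck_lefts: "npos bs = 0 \<Longrightarrow> valid bs \<Longrightarrow> dyck (lefts bs)"
proof (induction bs)
  case (Cons b bs)
  then show ?case by (cases b rule: blk.cases) (auto intro: dyck.Cons)
qed (simp add: dyck.Nil)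

lemma rights_eq_blks: "nneg bs = 0 \<Longrightarrow> rights bs = blks bs"
proof (induction bs)
  case (Cons b bs)
  then show ?case by (cases b rule: blk.cases) auto
qed simp

lemma last_pos_split:
  assumes "npos as > 0"
  obtains as1 c as2 where "as = as1 @ (True, c) # as2" "npos as2 = 0"
proof -
  from assms have "\<exists>as1 c as2. as = as1 @ (True, c) # as2 \<and> npos as2 = 0"
  proof (induction as)
    case (Cons b as)
    show ?case
    proof (cases "npos as > 0")
      case True
      then obtain as1 c as2 where "as = as1 @ (True, c) # as2" "npos as2 = 0" using Cons.IH by auto
      then show ?thesis by (intro exI[of _ "b # as1"]) auto
    next
      case False
      then have "b = (True, snd b)" using Cons.prems by (cases b) (auto split: if_splits)
      then show ?thesis using False by (intro exI[of _ "[]"] exI[of _ "snd b"] exI[of _ as]) auto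
    qed
  qed simp
  with that show thesis by blast
qed

text \<open>The Dyck path \<open>m\<close> grows outwards from the boundary. A negative block of A
  or a positive one of B is already a Dyck path and is absorbed; otherwise a positive block of A and
  a negative one of B enclose \<open>m\<close> together.\<close>

lemma dyck_lefts_rights:
  "dyck m \<Longrightarrow> valid as \<Longrightarrow> valid bs \<Longrightarrow> npos as = nneg bs \<Longrightarrow> dyck (lefts as @ m @ rights bs)"
proof (induction "length as + length bs" arbitrary: as m bs rule: less_induct)
  case less
  show ?case
  proof (cases as rule: rev_cases)
    case as: (snoc as' a)
    show ?thesis
    proof (cases a rule: blk.cases)
      case a: (1 c)
      show ?thesis
      proof (cases bs)
        case Nil
        with less.prems as a show ?thesis by simp
      next
        case bs: (Cons b bs')
        show ?thesis
        proof (cases b rule: blk.cases)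
          case b: (1 c')
          have "dyck (lefts as @ (m @ Up # c' @ [Down]) @ rights bs')"
            by (rule less.hyps) (use less.prems as a bs b in \<open>auto intro: dyck_append dyck_wrap\<close>)
          then show ?thesis using bs b by simp
        next
          case b: (2 c')
          have "dyck (lefts as' @ (Up # (c @ (Up # m @ Down # c')) @ [Down]) @ rights bs')"
            by (rule less.hyps)
              (use less.prems as a bs b in \<open>auto intro: dyck_append[OF _ dyck.Cons] dyck_wrap simp del: append_assoc\<close>)
          then show ?thesis using as a bs b by simp
        qed
      qed
    next
      case a: (2 c)
      have "dyck (lefts as' @ (Up # c @ Down # m) @ rights bs)"
        by (rule less.hyps) (use less.prems as a in \<open>auto intro: dyck.Cons\<close>)
      then show ?thesis using as a by simp
    qed
  next
    case as: Nil
    then have "dyck (rights bs)"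
    proof -
      obtain "nneg bs = 0" using less.prems as by simp
      then show ?thesis using less.prems(3)
      proof (induction bs)
        case (Cons b bs)
        then show ?case by (cases b rule: blk.cases) (auto intro: dyck.Cons)
      qed (simp add: dyck.Nil)
    qed
    then show ?thesis using as less.prems by (auto intro: dyck_append)
  qed
qed

text \<open>The boundary between \<open>as\<close> and \<open>bs\<close> is forced: \<open>as\<close> has length \<open>d 0 x\<close>, by \<open>layout_d\<close>.\<close>

definition layout :: "block list \<Rightarrow> block list \<Rightarrow> path \<Rightarrow> path \<Rightarrow> bool" where
  "layout as bs x w \<longleftrightarrow> valid as \<and> valid bs \<and> npos as = nneg bs \<and>
    x = blks as @ blks bs \<and> w = lefts as @ rights bs"

lemma layout_dyck: "layout as bs x w \<Longrightarrow> dyck w"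
  using dyck_lefts_rights[OF dyck.Nil] by (auto simp: layout_def)

lemma layout_d: "layout as bs x w \<Longrightarrow> d 0 x = length as"
  using length_pos_starting_down[of "as @ bs"] npos_plus_nneg[of as] by (simp add: layout_def d_pos)

lemma layout_exists:
  assumes "net x = 0"
  obtains as bs w where "layout as bs x w"
proof -
  obtain bs where bs: "valid bs" "x = blks bs" using assms by (rule balanced_blocks)
  \<comment> \<open>Cutting after as many excursions as there are negative ones balances the sides:
    positive ones in the first part take the places of the negative ones in the second.\<close>
  define n where "n = nneg bs"
  have split: "take n bs @ drop n bs = bs" by simp
  have "n \<le> length bs" using npos_plus_nneg[of bs] by (simp add: n_def)
  moreover have "nneg (take n bs) + nneg (drop n bs) = n"
    unfolding n_def nneg_simps(3)[symmetric] by simp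
  ultimately have "npos (take n bs) = nneg (drop n bs)"
    using npos_plus_nneg[of "take n bs"] by simp
  moreover have "valid (take n bs) \<and> valid (drop n bs)"
    using bs(1) unfolding valid_simps(3)[symmetric] by simp
  moreover have "x = blks (take n bs) @ blks (drop n bs)"
    unfolding bs(2) concat_append[symmetric] map_append[symmetric] by simp
  ultimately show thesis using that unfolding layout_def by blast
qed

section \<open>Bracket matching of up-steps with down-steps\<close>

definition matched :: "path \<Rightarrow> nat \<Rightarrow> nat \<Rightarrow> bool" where
  "matched w i j \<longleftrightarrow> i < j \<and> j < length w \<and> w ! i = Up \<and> w ! j = Down \<and>
    height w i = height w (Suc j) \<and> (\<forall>l. i < l \<and> l \<le> j \<longrightarrow> height w i < height w l)"

lemma height_append_length: "height (x @ y) (length x) = net x"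
  using height_append2[of x y 0] by simp

lemma matchedI:
  assumes "dyck b"
  shows "matched (a @ Up # b @ Down # c) (length a) (Suc (length a + length b))"
proof -
  let ?w = "a @ Up # b @ Down # c"
  have h0: "height ?w (length a) = net a" by (rule height_append_length)
  have hb: "height ?w (length a + Suc i) = net a + 1 + height b i" if "i \<le> length b" for i
    using that height_append2[of a "Up # b @ Down # c" "Suc i"] by (simp add: height_append1)
  have "height ?w (Suc (Suc (length a + length b))) = net a"
    using height_append2[of "a @ Up # b" "Down # c" 1] dyck_net[OF assms] by simp
  moreover have "net a < height ?w l" if l: "length a < l" "l \<le> Suc (length a + length b)" for l
  proof -
    define i where "i = l - Suc (length a)"
    have i: "l = length a + Suc i" "i \<le> length b" using l by (auto simp: i_def)
    show ?thesis using hb[of i] i dyck_height_nonneg[OF assms, of i] by simp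
  qed
  ultimately show ?thesis
    unfolding matched_def h0 by (simp add: nth_append)
qed

lemma matched_extend:
  assumes "matched a i j"
  shows "matched (p @ a @ s) (length p + i) (length p + j)"
proof -
  have *: "height (p @ a @ s) (length p + l) = net p + height a l" if "l \<le> length a" for l
    using that by (simp add: height_append2 height_append1)
  have "height (p @ a @ s) (length p + i) < height (p @ a @ s) l"
    if l: "length p + i < l" "l \<le> length p + j" for l
  proof -
    define m where "m = l - length p"
    have m: "l = length p + m" "i < m" "m \<le> j" using l by (auto simp: m_def)
    show ?thesis unfolding m(1) using assms m by (auto simp: * matched_def)
  qed
  then show ?thesis
    using assms *[of i] *[of "Suc j"] by (auto simp: matched_def nth_append)
qed

lemma dyck_matched:
  "dyck w \<Longrightarrow> j < length w \<Longrightarrow> w ! j = Down \<Longrightarrow> \<exists>i. matched w i j"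
proof (induction arbitrary: j rule: dyck.induct)
  case (Cons a b)
  let ?w = "Up # a @ Down # b"
  consider "j = 0" | l where "j = Suc l" "l < length a" | "j = Suc (length a)"
    | l where "j = Suc (Suc (length a + l))" "l < length b"
  proof (cases j)
    case (Suc l)
    consider "l < length a" | "l = length a" | "l > length a" by linarith
    then show thesis
    proof cases
      case 3
      then have "j = Suc (Suc (length a + (l - Suc (length a))))" "l - Suc (length a) < length b"
        using Suc Cons.prems by auto
      with that(4) show thesis .
    qed (use Suc that in auto)
  qed (use that in auto)
  then show ?case
  proof cases
    case 1
    with Cons.prems show ?thesis by simp
  next
    case (2 l)
    then obtain i where "matched a i l" using Cons.IH(1)[of l] Cons.prems by (auto simp: nth_append)
    from matched_extend[OF this, of "[Up]" "Down # b"] 2 show ?thesis by auto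
  next
    case 3
    then show ?thesis using matchedI[OF Cons.hyps(1), of "[]" b] by auto
  next
    case (4 l)
    then obtain i where "matched b i l" using Cons.IH(2)[of l] Cons.prems by (auto simp: nth_append)
    from matched_extend[OF this, of "Up # a @ [Down]" "[]"] 4 show ?thesis by auto
  qed
qed simp

text \<open>
  With \<open>m\<close> the partner of \<open>a\<close> in the matching of \<open>w\<close>, \<open>right_end w a p\<close> means \<open>p = max a m\<close> and
  \<open>left_end w a p\<close> means \<open>p = min a m\<close>.
\<close>

definition right_end :: "path \<Rightarrow> nat \<Rightarrow> nat \<Rightarrow> bool" where
  "right_end w a p \<longleftrightarrow> matched w a p \<or> p = a \<and> (\<exists>i. matched w i a)"

definition left_end :: "path \<Rightarrow> nat \<Rightarrow> nat \<Rightarrow> bool" where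
  "left_end w a p \<longleftrightarrow> matched w p a \<or> p = a \<and> (\<exists>j. matched w a j)"

text \<open>
  In the plane tree of \<open>w\<close>, the flips walk around the children of a vertex from right to left or
  from left to right, depending on the parity of its depth, which is the parity of \<open>i\<close>.
\<close>

fun turn :: "nat \<Rightarrow> nat \<Rightarrow> nat \<times> nat" where
  "turn i j = (if odd j then (j + 1, j - 1) else (i + 1, i - 1))"

text \<open>Right ends are down-steps of \<open>w\<close> and left ends are up-steps. So after the
  first flip a position left of \<open>p\<close> is read, after the second one to its right, and one
  entry per position serves both.\<close>

definition neighbour :: "path \<Rightarrow> nat \<Rightarrow> nat \<Rightarrow> bool" where
  "neighbour w p q \<longleftrightarrow>
    (\<exists>j. matched w p j \<and> q = fst (turn p j)) \<or> (\<exists>i. matched w i p \<and> q = snd (turn i p))"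

text \<open>A positive \<open>b\<close> opens at the boundary and is closed by its own last step. A
  negative \<open>b\<close> puts a down-step there, whose partner is the last step of the last
  positive excursion of A.\<close>

lemma layout_right_end:
  assumes "layout as (b # bs) x w"
  shows "right_end w (length (blks as)) (length (blks as) + down_offset b)"
proof (cases b rule: blk.cases)
  case (1 c)
  then show ?thesis
    using matchedI[of c "lefts as" "rights bs"] assms by (auto simp: layout_def right_end_def)
next
  case (2 c)
  then obtain as1 c' as2 where "as = as1 @ (True, c') # as2" "npos as2 = 0"
    using assms last_pos_split[of as] by (auto simp: layout_def)
  then show ?thesis
    using matchedI[of "lefts as2" "lefts as1 @ Up # c'" "c @ Down # rights bs"] 2 assms
    by (auto simp: layout_def right_end_def dyck_lefts add.assoc)
qed

section \<open>Counting up-steps at height 1, to locate the flip made by \<open>h\<close>\<close>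

lemma pos_touching_up_dyck:
  "dyck c \<Longrightarrow> pos (touching Up 1) 1 c = pos (starting Up 1) 1 c"
  by (rule pos_dyck_cong) (auto simp: touching_def starting_def)

lemma pos_touching_up_empty: "dyck c \<Longrightarrow> pos (touching Up 1) 2 c = []"
  by (rule pos_dyck_empty) (auto simp: touching_def)

lemma pos_touching_up_snoc:
  assumes "dyck c" "dyck c2"
  shows "pos (touching Up 1) 1 (c @ Up # c2 @ [Down]) = pos (touching Up 1) 1 c @ [length c]"
  using assms pos_touching_up_empty[OF assms(2)]
  by (simp add: pos_append dyck_net touching_def)

text \<open>The surplus of a positive excursion is its opening step, which touches height 1 only at
  its end. Negative excursions never reach height 1.\<close>

lemma length_pos_touching_up:
  "valid bs \<Longrightarrow> length (pos (touching Up 1) 0 (blks bs)) = length (pos (starting Up 1) 0 (blks bs)) + npos bs"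
proof (induction bs)
  case (Cons b bs)
  then have d: "dyck (snd b)" by simp
  have "length (pos (touching Up 1) 0 (blk b)) = length (pos (starting Up 1) 0 (blk b)) + (if fst b then 1 else 0)"
  proof (cases b rule: blk.cases)
    case (1 c)
    with d show ?thesis
      by (simp add: pos_append dyck_net pos_touching_up_dyck touching_def[of _ _ _ Up]
          touching_def[of _ _ _ Down] starting_def[of _ _ _ Up] starting_def[of _ _ _ Down])
  next
    case (2 c)
    then have "pos (touching Up 1) (- 1) (compl c) = []" "pos (starting Up 1) (- 1) (compl c) = []"
      using d by (auto intro!: pos_compl_dyck_empty simp: touching_def starting_def)
    with 2 d show ?thesis
      by (simp add: pos_append dyck_net touching_def[of _ _ _ Up]
          touching_def[of _ _ _ Down] starting_def[of _ _ _ Up] starting_def[of _ _ _ Down])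
  qed
  with Cons d show ?case by (simp add: pos_append)
qed simp

lemma pos_touching_up_neg: "npos bs = 0 \<Longrightarrow> valid bs \<Longrightarrow> pos (touching Up 1) 0 (blks bs) = []"
proof (induction bs)
  case (Cons b bs)
  show ?case
  proof (cases b rule: blk.cases)
    case (2 c)
    then have "pos (touching Up 1) (- 1) (compl c) = []"
      using Cons.prems by (auto intro!: pos_compl_dyck_empty simp: touching_def)
    with 2 Cons show ?thesis
      by (simp add: pos_append dyck_net touching_def[of _ _ _ Up] touching_def[of _ _ _ Down])
  qed (use Cons.prems in simp)
qed simp

text \<open>Behind the flip made by \<open>g\<close> the path is raised by 2; there each negative
  excursion climbs from 1 to 2 exactly once, with its closing step.\<close>

lemma length_pos_starting_up:
  "valid bs \<Longrightarrow> length (pos (starting Up 1) 2 (blks bs)) = nneg bs"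
proof (induction bs)
  case (Cons b bs)
  then have d: "dyck (snd b)" by simp
  have "length (pos (starting Up 1) 2 (blk b)) = (if fst b then 0 else 1)"
  proof (cases b rule: blk.cases)
    case (1 c)
    then have "pos (starting Up 1) 3 c = []"
      using d by (auto intro!: pos_dyck_empty simp: starting_def)
    with 1 d show ?thesis
      by (simp add: pos_append dyck_net starting_def[of _ _ _ Up] starting_def[of _ _ _ Down])
  next
    case (2 c)
    then have "pos (starting Up 1) 1 (compl c) = []"
      using d by (auto intro!: pos_compl_dyck_empty simp: starting_def)
    with 2 d show ?thesis
      by (simp add: pos_append dyck_net starting_def[of _ _ _ Up] starting_def[of _ _ _ Down])
  qed
  with Cons d show ?case by (simp add: pos_append)
qed simp

text \<open>The last entry of the list: the last up-step of \<open>c\<close> touching height 1, or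
  the opening step of the excursion, at offset 0, if there is none.\<close>

definition flip_offset :: "path \<Rightarrow> nat" where
  "flip_offset c = (0 # map Suc (pos (touching Up 1) 1 c)) ! length (pos (touching Up 1) 1 c)"

lemma flip_offset_Nil: "flip_offset [] = 0"
  by (simp add: flip_offset_def)

lemma flip_offset_snoc:
  "dyck c \<Longrightarrow> dyck c2 \<Longrightarrow> flip_offset (c @ Up # c2 @ [Down]) = Suc (length c)"
  unfolding flip_offset_def by (subst (1 2) pos_touching_up_snoc) (auto simp: nth_append)

lemma nth_append_map:
  "n = length xs + length ys \<Longrightarrow> (xs @ map t (y # ys @ zs)) ! n = t ((y # ys) ! length ys)"
  using nth_map[of "length ys" "y # ys @ zs" t] nth_append[of "y # ys" zs "length ys"]
  by (simp add: nth_append del: nth_map list.map)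

text \<open>Up-steps from height 1 occur in \<open>as\<close>, in \<open>c\<close>, right after
  \<open>c\<close>, and once per negative excursion of \<open>bs\<close>. In \<open>as\<close> there
  are \<open>npos as = nneg bs\<close> more touching than starting steps, so the
  \<open>u_1\<close>-th touching step is the last one before the end of \<open>c\<close>.\<close>

lemma h_first_excursion:
  assumes "valid as" "valid bs" "npos as = nneg bs" "dyck c"
    and y: "y = blks as @ Up # c @ Up # blks bs"
  shows "h y = y[length (blks as) + flip_offset c := Down]"
proof -
  let ?A = "pos (touching Up 1) 0 (blks as)"
  let ?C = "pos (touching Up 1) 1 c"
  have T: "touching_steps Up 1 y = ?A @ map ((+) (length (blks as))) (0 # map Suc ?C @
    map ((+) (Suc (length c))) (pos (touching Up 1) 1 (Up # blks bs)))"
    using assms by (simp add: touching_steps_pos pos_append dyck_net touching_def[of _ _ 0 Up] comp_def)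
  have "Suc (u 1 y - 1) = Suc (length ?A + length ?C)"
    using assms by (simp add: u_pos pos_append dyck_net starting_def[of _ _ _ Up] comp_def
        length_pos_touching_up length_pos_starting_up pos_touching_up_dyck)
  then have "u 1 y - 1 = length ?A + length (map Suc ?C)" by simp
  with T have "touching_steps Up 1 y ! (u 1 y - 1) = length (blks as) + flip_offset c"
    by (simp only: nth_append_map) (simp add: flip_offset_def)
  then show ?thesis by (simp add: h_def)
qed

text \<open>The count is as before, since \<open>blks as2\<close> stays at or below 0 and
  \<open>compl c\<close> at or below 1, so neither has an up-step from height 1. The flip thus falls
  back to the last positive excursion of A.\<close>

lemma h_later_excursion:
  assumes "valid as1" "dyck c'" "valid as2" "npos as2 = 0" "valid bs" "npos as1 = nneg bs" "dyck c"
    and y: "y = blks as1 @ Up # c' @ Down # blks as2 @ Up # compl c @ Up # blks bs"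
  shows "h y = y[length (blks as1) + flip_offset c' := Down]"
proof -
  let ?A = "pos (touching Up 1) 0 (blks as1)"
  let ?C = "pos (touching Up 1) 1 c'"
  have "\<not> touching Up 1 1 Down" by (simp add: touching_def)
  have e: "pos (starting Up 1) 1 (compl c) = []" "pos (starting Up 1) 0 (blks as2) = []"
    using assms(3,4,7) length_pos_touching_up[of as2] pos_touching_up_neg[of as2]
    by (auto intro!: pos_compl_dyck_empty simp: starting_def)
  have T: "touching_steps Up 1 y = ?A @ map ((+) (length (blks as1))) (0 # map Suc ?C @
    map ((+) (Suc (length c'))) (pos (touching Up 1) 1 (Down # blks as2 @ Up # compl c @ Up # blks bs)))"
    using assms by (simp add: touching_steps_pos pos_append dyck_net touching_def[of _ _ 0 Up] comp_def)
  have "Suc (u 1 y - 1) = Suc (length ?A + length ?C)"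
    using assms e by (simp add: u_pos pos_append dyck_net starting_def[of _ _ _ Up]
        starting_def[of _ _ _ Down] comp_def
        length_pos_touching_up length_pos_starting_up pos_touching_up_dyck)
  then have "u 1 y - 1 = length ?A + length (map Suc ?C)" by simp
  with T have "touching_steps Up 1 y ! (u 1 y - 1) = length (blks as1) + flip_offset c'"
    by (simp only: nth_append_map) (simp add: flip_offset_def)
  then show ?thesis by (simp add: h_def)
qed

text \<open>There is one touching down-step per excursion and \<open>d 0 x = length as\<close>, so
  the chosen step lies in the first excursion of B.\<close>

lemma layout_g:
  assumes "layout as (b # bs) x w"
  shows "g x = x[length (blks as) + down_offset b := Up]"
proof -
  have v: "valid as" "valid bs" "dyck (snd b)" "x = blks as @ blks (b # bs)"
    using assms by (auto simp: layout_def)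
  then have "touching_steps Down 0 x = pos (touching Down 0) 0 (blks as) @
      map ((+) (length (blks as))) (down_offset b # map ((+) (length (blk b))) (pos (touching Down 0) 0 (blks bs)))"
    by (simp add: touching_steps_pos pos_append pos_touching_down_blk)
  then show ?thesis
    using layout_d[OF assms] v length_pos_touching_down[of as] by (simp add: g_def nth_append)
qed

text \<open>Cases: the sign of the first excursion of B, and whether the excursion cut by
  \<open>h\<close> is hollow. Even lengths settle the parity tests in \<open>turn\<close>.\<close>

lemma layout_step:
  assumes lay: "layout as bs x w" and ne: "bs \<noteq> []"
  obtains as' bs' p p' q where
    "layout as' bs' (f x) w" "below_length (as' @ bs') = below_length (as @ bs) + 2"
    "f x = x[p := Up, p' := Down]"
    "right_end w (length (blks as)) p" "neighbour w p q" "left_end w q p'"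
    "neighbour w p' (length (blks as'))"
proof -
  obtain b bs2 where bs: "bs = b # bs2" using ne by (cases bs) auto
  have v: "valid as" "valid bs2" "dyck (snd b)"
    and x: "x = blks as @ blk b @ blks bs2" and w: "w = lefts as @ right_blk b @ rights bs2"
    and n: "npos as = nneg bs2 + (if fst b then 0 else 1)"
    using lay bs by (auto simp: layout_def)
  define a where "a = length (blks as)"
  define p where "p = a + down_offset b"
  have "even a" using even_blks v(1) by (simp add: a_def)
  have right: "right_end w a p"
    using layout_right_end lay bs by (simp add: a_def p_def)
  have g: "g x = x[p := Up]"
    using layout_g lay bs by (simp add: a_def p_def)
  show thesis
  proof (cases b rule: blk.cases)
    case b: (1 c)
    have dc: "dyck c" using v(3) b by simp
    have gx: "g x = blks as @ Up # c @ Up # blks bs2"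
      unfolding g using list_update_length[of "blks as @ Up # c" Down "blks bs2" Up] x b
      by (simp add: p_def a_def)
    have fx: "f x = x[p := Up, a + flip_offset c := Down]"
      using h_first_excursion[OF v(1,2) _ dc gx] n b g by (simp add: f_def a_def)
    have fx': "f x = (blks as @ Up # c @ Up # blks bs2)[a + flip_offset c := Down]"
      using fx g gx by simp
    have mp: "matched w a p"
      using matchedI[OF dc, of "lefts as" "rights bs2"] w b by (simp add: a_def p_def)
    have "odd p" using \<open>even a\<close> dyck_even[OF dc] b by (simp add: p_def)
    from dc show thesis
    proof (cases rule: dyck_snoc_cases)
      case 1
      \<comment> \<open>\<open>Up Down\<close> in B becomes \<open>Down Up\<close> in A; both
        contribute \<open>Up Down\<close> to \<open>w\<close>.\<close>
      have "f x = blks as @ Down # Up # blks bs2"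
        unfolding fx' using 1 by (simp add: flip_offset_Nil a_def)
      then have "layout (as @ [(False, [])]) bs2 (f x) w"
        using v n w b 1 by (simp add: layout_def dyck.Nil)
      moreover have "neighbour w p a" "neighbour w a (length (blks (as @ [(False, [])])))"
        using mp \<open>odd p\<close> 1 b by (auto simp: neighbour_def p_def a_def)
      moreover have "left_end w a a" using mp by (auto simp: left_end_def)
      moreover have "f x = x[p := Up, a := Down]" using fx 1 by (simp add: flip_offset_Nil)
      ultimately show thesis
        using that[of "as @ [(False, [])]" bs2 p a a] right bs b 1 by (simp add: a_def)
    next
      case (2 c1 c2)
      obtain ds where ds: "valid ds" "c2 = blks ds" "nneg ds = 0"
        using 2(2) by (rule dyck_blocks)
      \<comment> \<open>In \<open>w\<close> the pieces read \<open>Up c1 Up\<close>, then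
        \<open>c2\<close>, then \<open>Down Down\<close>, which together are again
        \<open>Up c Down\<close>.\<close>
      let ?as = "as @ [(True, c1)]" and ?bs = "ds @ (False, []) # bs2"
      have "f x = blks as @ Up # c1 @ Down # c2 @ Down # Up # blks bs2"
        unfolding fx' using 2 list_update_length[of "blks as @ Up # c1" Up "c2 @ Down # Up # blks bs2" Down]
        by (simp add: flip_offset_snoc a_def)
      then have "layout ?as ?bs (f x) w"
        using v n w b 2 ds by (simp add: layout_def dyck.Nil rights_eq_blks)
      moreover have m: "matched w (a + Suc (length c1)) (p - 1)"
        using matchedI[OF 2(2), of "lefts as @ Up # c1" "Down # rights bs2"] w b 2
        by (simp add: a_def p_def add.assoc)
      moreover have "neighbour w p (p - 1)"
        using mp \<open>odd p\<close> by (auto simp: neighbour_def)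
      moreover have "left_end w (p - 1) (a + Suc (length c1))"
        using m by (auto simp: left_end_def)
      moreover have "neighbour w (a + Suc (length c1)) (length (blks ?as))"
        using m \<open>odd p\<close> by (auto simp: neighbour_def a_def intro!: exI[of _ "p - 1"])
      moreover have "f x = x[p := Up, a + Suc (length c1) := Down]"
        using fx 2 by (simp add: flip_offset_snoc)
      moreover have "below_length ds = 0"
        using ds(3) by (induction ds) (auto split: if_splits)
      ultimately show thesis
        using that[of ?as ?bs p "a + Suc (length c1)" "p - 1"] right bs b by (simp add: a_def)
    qed
  next
    case b: (2 c)
    have dc: "dyck c" using v(3) b by simp
    obtain as1 c' as2 where as: "as = as1 @ (True, c') # as2" "npos as2 = 0"
      using n b last_pos_split[of as] by auto
    have v': "valid as1" "dyck c'" "valid as2" using v as by auto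
    define a1 where "a1 = length (blks as1)"
    have "even a1" using even_blks v'(1) by (simp add: a1_def)
    have n': "npos as1 = nneg bs2" using n as b by simp
    have gx: "g x = blks as1 @ Up # c' @ Down # blks as2 @ Up # compl c @ Up # blks bs2"
      unfolding g using list_update_length[of "blks as" Down "compl c @ Up # blks bs2" Up] x b as
      by (simp add: p_def a_def)
    have fx: "f x = x[p := Up, a1 + flip_offset c' := Down]"
      using h_later_excursion[OF v' as(2) v(2) n' dc gx] g by (simp add: f_def a1_def)
    have fx': "f x = (blks as1 @ Up # c' @ Down # blks as2 @ Up # compl c @ Up # blks bs2)[a1 + flip_offset c' := Down]"
      using fx g gx by simp
    \<comment> \<open>From the last positive excursion of A to the first of B, \<open>w\<close>
      reads \<open>Up c' Up (lefts as2) Down c Down\<close>, that is \<open>Up c' ?e Down\<close>;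
      so \<open>?e\<close> becomes the inside of the new negative excursion.\<close>
    let ?e = "Up # lefts as2 @ Down # c"
    have de: "dyck ?e" "compl ?e = Down # blks as2 @ Up # compl c"
      using as v' dc by (auto intro: dyck.Cons simp: dyck_lefts compl_lefts)
    \<comment> \<open>The step before the closing step of the excursion that is cut: its opening
      step if \<open>c'\<close> is empty, otherwise the last step of \<open>c'\<close>.\<close>
    define q where "q = a1 + length c'"
    have mp: "matched w (Suc q) p"
      using matchedI[of "lefts as2" "lefts as1 @ Up # c'" "c @ Down # rights bs2"] w b as v'
      by (simp add: a_def p_def q_def a1_def dyck_lefts add.assoc)
    have "even q" "even p" using \<open>even a1\<close> \<open>even a\<close> dyck_even[OF v'(2)] b by (simp_all add: q_def p_def)
    have nb: "neighbour w p q"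
      using mp \<open>even p\<close> by (auto simp: neighbour_def intro!: exI[of _ "Suc q"])
    from v'(2) show thesis
    proof (cases rule: dyck_snoc_cases)
      case 1
      let ?as = "as1 @ [(False, ?e)]"
      have "f x = blks as1 @ Down # compl ?e @ Up # blks bs2"
        unfolding fx' de(2) using 1 by (simp add: flip_offset_Nil a1_def)
      then have "layout ?as bs2 (f x) w"
        using v' v n' w b 1 as de by (simp add: layout_def)
      moreover have m: "matched w q (p + Suc (length c))"
        using matchedI[OF de(1), of "lefts as1" "rights bs2"] w b as 1
        by (simp add: a_def p_def q_def a1_def add.assoc)
      moreover have "left_end w q q" using m by (auto simp: left_end_def)
      moreover have "neighbour w q (length (blks ?as))"
        using m \<open>even p\<close> dyck_even[OF dc] b as 1
        by (auto simp: neighbour_def a1_def q_def p_def a_def intro!: exI[of _ "p + Suc (length c)"])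
      moreover have "f x = x[p := Up, q := Down]" using fx 1 by (simp add: flip_offset_Nil q_def)
      \<comment> \<open>\<open>as2\<close> and the first block of B were below already; only the
        steps \<open>q\<close> and \<open>Suc q\<close> are new there.\<close>
      moreover have "below_length as2 = length (blks as2)"
        using as(2) by (induction as2) (auto split: if_splits)
      ultimately show thesis
        using that[of ?as bs2 p q q] right bs b as nb by (simp add: a_def)
    next
      case (2 c1 c2)
      obtain ds where ds: "valid ds" "c2 = blks ds" "nneg ds = 0"
        using 2(2) by (rule dyck_blocks)
      let ?as = "as1 @ [(True, c1)]" and ?bs = "ds @ (False, ?e) # bs2" and ?p = "a1 + Suc (length c1)"
      have "f x = blks as1 @ Up # c1 @ Down # c2 @ Down # compl ?e @ Up # blks bs2"
        unfolding fx' de(2)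
        using 2 list_update_length[of "blks as1 @ Up # c1" Up "c2 @ Down # Down # blks as2 @ Up # compl c @ Up # blks bs2" Down]
        by (simp add: flip_offset_snoc a1_def)
      then have "layout ?as ?bs (f x) w"
        using v v' n' w b 2 ds as de by (simp add: layout_def rights_eq_blks)
      moreover have m: "matched w ?p q"
        using matchedI[OF 2(2), of "lefts as1 @ Up # c1" "Up # lefts as2 @ Down # c @ Down # rights bs2"] w b 2 as
        by (simp add: a1_def q_def add.assoc)
      moreover have "left_end w q ?p"
        using m by (auto simp: left_end_def)
      moreover have "neighbour w ?p (length (blks ?as))"
        using m \<open>even q\<close> by (auto simp: neighbour_def a1_def intro!: exI[of _ q])
      moreover have "f x = x[p := Up, ?p := Down]"
        using fx 2 by (simp add: flip_offset_snoc)
      moreover have "below_length ds = 0"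
        using ds(3) by (induction ds) (auto split: if_splits)
      moreover have "below_length as2 = length (blks as2)"
        using as(2) by (induction as2) (auto split: if_splits)
      ultimately show thesis
        using that[of ?as ?bs p ?p q] right bs b as nb by (simp add: a_def)
    qed
  qed
qed

section \<open>The invariant path, step by step\<close>

text \<open>A scan knows only the current height and the side of the boundary, so
  \<open>lefts\<close> and \<open>rights\<close> are recast as rules for single steps.\<close>

primrec conv :: "(int \<Rightarrow> step \<Rightarrow> bool) \<Rightarrow> int \<Rightarrow> path \<Rightarrow> path" where
  "conv P c [] = []"
| "conv P c (s # x) = (if P c s then flip s else s) # conv P (c + rise s) x"

lemma conv_append: "conv P c (x @ y) = conv P c x @ conv P (c + net x) y"
  by (induction x arbitrary: c) (auto simp: add.assoc)

lemma length_conv [simp]: "length (conv P c x) = length x"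
  by (induction x arbitrary: c) auto

lemma nth_conv:
  "i < length x \<Longrightarrow> conv P c x ! i = (if P (c + height x i) (x ! i) then flip (x ! i) else x ! i)"
proof (induction x arbitrary: c i)
  case (Cons s x)
  then show ?case by (cases i) (auto simp: add.assoc)
qed simp

lemma conv_dyck:
  "dyck w \<Longrightarrow> (\<And>b s. c \<le> b \<Longrightarrow> c \<le> b + rise s \<Longrightarrow> \<not> P b s) \<Longrightarrow> conv P c w = w"
proof (induction arbitrary: c rule: dyck.induct)
  case (Cons a b)
  have "conv P (c + 1) a = a" by (rule Cons.IH) (use Cons.prems in auto)
  moreover have "conv P c b = b" by (rule Cons.IH) (use Cons.prems in auto)
  ultimately show ?case
    using Cons.prems[of c Up] Cons.prems[of "c + 1" Down] dyck_net[OF Cons.hyps(1)]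
    by (simp add: conv_append)
qed simp

lemma conv_compl_dyck:
  "dyck w \<Longrightarrow> (\<And>b s. b \<le> c \<Longrightarrow> b + rise s \<le> c \<Longrightarrow> P b s) \<Longrightarrow> conv P c (compl w) = w"
proof (induction arbitrary: c rule: dyck.induct)
  case (Cons a b)
  have "conv P (c - 1) (compl a) = a" by (rule Cons.IH) (use Cons.prems in auto)
  moreover have "conv P c (compl b) = b" by (rule Cons.IH) (use Cons.prems in auto)
  ultimately show ?case
    using Cons.prems[of c Down] Cons.prems[of "c - 1" Up] dyck_net[OF Cons.hyps(1)]
    by (simp add: conv_append)
qed simp

definition ends_low :: "int \<Rightarrow> step \<Rightarrow> bool" where
  "ends_low b s \<longleftrightarrow> b + rise s \<le> 0"

definition starts_neg :: "int \<Rightarrow> step \<Rightarrow> bool" where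
  "starts_neg b s \<longleftrightarrow> b < 0"

text \<open>In A the steps that change are all steps of negative excursions and the closing steps of
  positive ones, and these are the ones ending at or below 0.\<close>

lemma lefts_eq_conv: "valid as \<Longrightarrow> lefts as = conv ends_low 0 (blks as)"
proof (induction as)
  case (Cons b as)
  have "conv ends_low 0 (blk b) = left_blk b"
  proof (cases b rule: blk.cases)
    case (1 c)
    then have "conv ends_low 1 c = c" "net c = 0"
      using Cons.prems by (auto intro!: conv_dyck simp: ends_low_def dyck_net)
    with 1 show ?thesis by (simp add: conv_append ends_low_def[of _ Up] ends_low_def[of _ Down])
  next
    case (2 c)
    then have "conv ends_low (- 1) (compl c) = c" "net c = 0"
      using Cons.prems by (auto intro!: conv_compl_dyck simp: ends_low_def dyck_net)
    with 2 show ?thesis by (simp add: conv_append ends_low_def[of _ Up] ends_low_def[of _ Down])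
  qed
  with Cons show ?case by (simp add: conv_append)
qed simp

text \<open>In B exactly the steps of negative excursions after the opening one change, and only
  these start below 0.\<close>

lemma rights_eq_conv: "valid bs \<Longrightarrow> rights bs = conv starts_neg 0 (blks bs)"
proof (induction bs)
  case (Cons b bs)
  have "conv starts_neg 0 (blk b) = right_blk b"
  proof (cases b rule: blk.cases)
    case (1 c)
    then have "conv starts_neg 1 c = c" "net c = 0"
      using Cons.prems by (auto intro!: conv_dyck simp: starts_neg_def dyck_net)
    with 1 show ?thesis by (simp add: conv_append starts_neg_def)
  next
    case (2 c)
    then have "conv starts_neg (- 1) (compl c) = c" "net c = 0"
      using Cons.prems by (auto intro!: conv_compl_dyck simp: starts_neg_def dyck_net)
    with 2 show ?thesis by (simp add: conv_append starts_neg_def)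
  qed
  with Cons show ?case by (simp add: conv_append)
qed simp

lemma layout_nth:
  assumes "layout as bs x w" "i < length x"
  shows "w ! i = (if (if i < length (blks as) then height x (Suc i) \<le> 0 else height x i < 0)
    then flip (x ! i) else x ! i)"
proof -
  have v: "valid as" "valid bs" "x = blks as @ blks bs" "w = conv ends_low 0 (blks as) @ conv starts_neg 0 (blks bs)"
    using assms(1) by (auto simp: layout_def lefts_eq_conv rights_eq_conv)
  show ?thesis
  proof (cases "i < length (blks as)")
    case True
    then have "height x (Suc i) = height (blks as) i + rise (blks as ! i)" "x ! i = blks as ! i"
      by (simp_all add: v(3) height_append1 height_Suc nth_append)
    with True show ?thesis by (simp add: v(4) nth_append nth_conv ends_low_def)
  next
    case False
    then obtain l where l: "i = length (blks as) + l" using le_Suc_ex not_less by blast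
    then have "height x i = height (blks bs) l" "x ! i = blks bs ! l" "l < length (blks bs)"
      using assms(2) v(1) by (simp_all add: v(3) height_append2 nth_append)
    with False l show ?thesis by (simp add: v(4) nth_append nth_conv starts_neg_def)
  qed
qed

lemma layout_length: "layout as bs x w \<Longrightarrow> length w = length x"
  by (simp add: layout_def)

text \<open>With \<open>layout_d\<close>, the boundary lies right after the \<open>d_0\<close>-th
  return to height 0, so one counter finds it.\<close>

lemma card_returns:
  assumes "layout as bs x w"
  shows "card {i. i < length (blks as) \<and> height x (Suc i) = 0} = length as"
proof -
  have "{i. i < length (blks as) \<and> height x (Suc i) = 0} =
      {i. i < length (blks as) \<and> returning (height (blks as) i) (blks as ! i)}"
    using assms by (auto simp: layout_def height_append1 height_Suc returning_def nth_append)
  then show ?thesis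
    using assms length_pos_returning[of as] by (simp add: layout_def length_pos)
qed

lemma net_eq: "net x = 2 * int (card {i. i < length x \<and> x ! i = Up}) - int (length x)"
proof -
  have "net x = 2 * int (length (pos (\<lambda>_ s. s = Up) c x)) - int (length x)" for c
  proof (induction x arbitrary: c)
    case (Cons s x)
    then show ?case by (cases s) auto
  qed simp
  from this[of 0] show ?thesis by (simp add: length_pos)
qed

section \<open>Executions without output\<close>

primrec exec_wp :: "nat \<Rightarrow> instr \<Rightarrow> (state \<Rightarrow> bool) \<Rightarrow> state \<Rightarrow> bool" where
  "exec_wp N (Const r c) Q s \<longleftrightarrow> \<bar>c\<bar> \<le> int N \<and> Q (s\<lparr>regs := (regs s)(r := c)\<rparr>)"
| "exec_wp N (Add r a b) Q s \<longleftrightarrow>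
    \<bar>regs s a + regs s b\<bar> \<le> int N \<and> Q (s\<lparr>regs := (regs s)(r := regs s a + regs s b)\<rparr>)"
| "exec_wp N (Sub r a b) Q s \<longleftrightarrow>
    \<bar>regs s a - regs s b\<bar> \<le> int N \<and> Q (s\<lparr>regs := (regs s)(r := regs s a - regs s b)\<rparr>)"
| "exec_wp N (Load r a) Q s \<longleftrightarrow> valid_address N (regs s a) \<and> \<bar>mem s (nat (regs s a))\<bar> \<le> int N \<and>
    Q (s\<lparr>regs := (regs s)(r := mem s (nat (regs s a)))\<rparr>)"
| "exec_wp N (Store a r) Q s \<longleftrightarrow> valid_address N (regs s a) \<and>
    Q (s\<lparr>mem := (mem s)(nat (regs s a) := regs s r)\<rparr>)"
| "exec_wp N Emit Q s \<longleftrightarrow> False"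

text \<open>Loops and \<open>Emit\<close> get \<open>False\<close>, so \<open>wp\<close> also
  guarantees termination, ticks only, and the static time bound \<open>cost\<close>.\<close>

primrec wp :: "nat \<Rightarrow> com \<Rightarrow> (state \<Rightarrow> bool) \<Rightarrow> state \<Rightarrow> bool" where
  "wp N Skip Q s \<longleftrightarrow> Q s"
| "wp N (Do i) Q s \<longleftrightarrow> exec_wp N i Q s"
| "wp N (Seq c1 c2) Q s \<longleftrightarrow> wp N c1 (wp N c2 Q) s"
| "wp N (If a b c1 c2) Q s \<longleftrightarrow> (if regs s a < regs s b then wp N c1 Q s else wp N c2 Q s)"
| "wp N (While a b c) Q s \<longleftrightarrow> False"

primrec cost :: "com \<Rightarrow> nat" where
  "cost Skip = 0"
| "cost (Do i) = 1"
| "cost (Seq c1 c2) = cost c1 + cost c2"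
| "cost (If a b c1 c2) = Suc (max (cost c1) (cost c2))"
| "cost (While a b c) = 0"

definition quiet :: "nat \<Rightarrow> com \<Rightarrow> state \<Rightarrow> nat \<Rightarrow> (state \<Rightarrow> bool) \<Rightarrow> bool" where
  "quiet N c s t Q \<longleftrightarrow> (\<exists>tr s'. exec N c s tr s' \<and> set tr \<subseteq> {Tick} \<and> length tr \<le> t \<and> Q s')"

lemma quietI: "exec N c s tr s' \<Longrightarrow> set tr \<subseteq> {Tick} \<Longrightarrow> length tr \<le> t \<Longrightarrow> Q s' \<Longrightarrow> quiet N c s t Q"
  by (auto simp: quiet_def)

lemma quiet_Seq:
  assumes "quiet N c1 s t1 R" "\<And>s'. R s' \<Longrightarrow> quiet N c2 s' t2 Q"
  shows "quiet N (Seq c1 c2) s (t1 + t2) Q"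
proof -
  obtain tr1 s1 where 1: "exec N c1 s tr1 s1" "set tr1 \<subseteq> {Tick}" "length tr1 \<le> t1" "R s1"
    using assms(1) by (auto simp: quiet_def)
  obtain tr2 s2 where 2: "exec N c2 s1 tr2 s2" "set tr2 \<subseteq> {Tick}" "length tr2 \<le> t2" "Q s2"
    using assms(2)[OF 1(4)] by (auto simp: quiet_def)
  show ?thesis by (rule quietI[OF exec.Seq[OF 1(1) 2(1)]]) (use 1 2 in auto)
qed

lemma quiet_wp: "wp N c Q s \<Longrightarrow> quiet N c s (cost c) Q"
proof (induction c arbitrary: s Q)
  case Skip
  then show ?case by (intro quietI[OF exec.Skip]) auto
next
  case (Do i)
  obtain s' where "exec_instr N i s = Some (Tick, s')" "Q s'"
    using Do by (cases i) (auto simp: set_reg_def)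
  then show ?case by (intro quietI[OF exec.Do]) auto
next
  case (Seq c1 c2)
  then show ?case using quiet_Seq[of N c1 s "cost c1" "wp N c2 Q"] by simp
next
  case (If a b c1 c2)
  show ?case
  proof (cases "regs s a < regs s b")
    case True
    then obtain tr s' where 1: "exec N c1 s tr s'" "set tr \<subseteq> {Tick}" "length tr \<le> cost c1" "Q s'"
      using If.IH(1)[of Q s] If.prems by (auto simp: quiet_def)
    show ?thesis by (rule quietI[OF exec.IfTrue[OF True 1(1)]]) (use 1 in auto)
  next
    case False
    then obtain tr s' where 1: "exec N c2 s tr s'" "set tr \<subseteq> {Tick}" "length tr \<le> cost c2" "Q s'"
      using If.IH(2)[of Q s] If.prems by (auto simp: quiet_def)
    show ?thesis by (rule quietI[OF exec.IfFalse[OF False 1(1)]]) (use 1 in auto)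
  qed
qed simp

lemma quiet_While:
  assumes step: "\<And>j s. j < m \<Longrightarrow> I j s \<Longrightarrow> regs s a < regs s b \<and> wp N c (I (Suc j)) s"
    and exit: "\<And>s. I m s \<Longrightarrow> \<not> regs s a < regs s b"
    and init: "I 0 s"
  shows "quiet N (While a b c) s (m * Suc (cost c) + 1) (I m)"
proof -
  have "quiet N (While a b c) s ((m - j) * Suc (cost c) + 1) (I m)" if "j \<le> m" "I j s" for j s
    using that
  proof (induction "m - j" arbitrary: j s)
    case 0
    then show ?case using exit by (intro quietI[OF exec.WhileFalse]) auto
  next
    case (Suc n)
    then have j: "j < m" "Suc j \<le> m" "n = m - Suc j" by simp_all
    note st = step[OF j(1) Suc.prems(2)]
    obtain tr1 s1 where 1: "exec N c s tr1 s1" "set tr1 \<subseteq> {Tick}" "length tr1 \<le> cost c" "I (Suc j) s1"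
      using quiet_wp[OF conjunct2[OF st]] by (auto simp: quiet_def)
    obtain tr2 s2 where 2: "exec N (While a b c) s1 tr2 s2" "set tr2 \<subseteq> {Tick}"
      "length tr2 \<le> (m - Suc j) * Suc (cost c) + 1" "I m s2"
      using Suc.hyps(1)[OF j(3,2) 1(4)] by (auto simp: quiet_def)
    have "(m - j) * Suc (cost c) = Suc (cost c) + (m - Suc j) * Suc (cost c)"
      unfolding mult_Suc[symmetric] using j(1) by (simp add: Suc_diff_Suc del: mult_Suc)
    then show ?case
      using 1 2 st by (intro quietI[OF exec.WhileTrue[OF _ 1(1) 2(1)]]) auto
  qed
  from this[of 0 s] init show ?thesis by simp
qed

lemma exec_While_Emit:
  assumes step: "\<And>j s. j < m \<Longrightarrow> I j s \<Longrightarrow> regs s a < regs s b \<and> wp N c (I (Suc j)) s"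
    and exit: "\<And>s. I m s \<Longrightarrow> \<not> regs s a < regs s b"
    and init: "I 0 s"
  shows "\<exists>segment s'.
    exec N (While a b (Seq c (Do Emit))) s (concat (map segment [1..<Suc m]) @ [Tick]) s' \<and>
    (\<forall>i \<in> {1..m}. length (segment i) \<le> cost c + 2 \<and>
      (\<exists>ticks s1. segment i = ticks @ [Visit (mem s1)] \<and> set ticks \<subseteq> {Tick} \<and> I i s1))"
proof -
  have "\<exists>segment s'.
    exec N (While a b (Seq c (Do Emit))) s (concat (map segment [Suc j..<Suc m]) @ [Tick]) s' \<and>
    (\<forall>i \<in> {Suc j..m}. length (segment i) \<le> cost c + 2 \<and>
      (\<exists>ticks s1. segment i = ticks @ [Visit (mem s1)] \<and> set ticks \<subseteq> {Tick} \<and> I i s1))"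
    if "j \<le> m" "I j s" for j s
    using that
  proof (induction "m - j" arbitrary: j s)
    case 0
    then show ?case using exec.WhileFalse[OF exit, of s N "Seq c (Do Emit)"] by auto
  next
    case (Suc n)
    then have j: "j < m" "Suc j \<le> m" "n = m - Suc j" by simp_all
    note st = step[OF j(1) Suc.prems(2)]
    obtain tr s1 where 1: "exec N c s tr s1" "set tr \<subseteq> {Tick}" "length tr \<le> cost c" "I (Suc j) s1"
      using quiet_wp[OF conjunct2[OF st]] by (auto simp: quiet_def)
    have body: "exec N (Seq c (Do Emit)) s (tr @ [Visit (mem s1)]) s1"
      by (rule exec.Seq[OF 1(1)]) (auto intro: exec.Do)
    obtain segment s2 where 2:
      "exec N (While a b (Seq c (Do Emit))) s1 (concat (map segment [Suc (Suc j)..<Suc m]) @ [Tick]) s2"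
      "\<forall>i \<in> {Suc (Suc j)..m}. length (segment i) \<le> cost c + 2 \<and>
        (\<exists>ticks s1. segment i = ticks @ [Visit (mem s1)] \<and> set ticks \<subseteq> {Tick} \<and> I i s1)"
      using Suc.hyps(1)[OF j(3,2) 1(4)] by blast
    \<comment> \<open>A segment begins with the tick of its loop test; test, body and
      \<open>Emit\<close> give \<open>cost c + 2\<close>. The failing last test is the trailing
      \<open>[Tick]\<close>.\<close>
    define segment' where "segment' = segment(Suc j := (Tick # tr) @ [Visit (mem s1)])"
    have "map segment' [Suc (Suc j)..<Suc m] = map segment [Suc (Suc j)..<Suc m]"
      by (auto simp: segment'_def)
    then have "concat (map segment' [Suc j..<Suc m]) @ [Tick] =
        Tick # (tr @ [Visit (mem s1)]) @ (concat (map segment [Suc (Suc j)..<Suc m]) @ [Tick])"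
      using j by (simp add: upt_conv_Cons segment'_def del: upt_Suc)
    then have "exec N (While a b (Seq c (Do Emit))) s (concat (map segment' [Suc j..<Suc m]) @ [Tick]) s2"
      using exec.WhileTrue[OF conjunct1[OF st] body 2(1)] by simp
    moreover have "length (segment' i) \<le> cost c + 2 \<and>
        (\<exists>ticks s1. segment' i = ticks @ [Visit (mem s1)] \<and> set ticks \<subseteq> {Tick} \<and> I i s1)"
      if "i \<in> {Suc j..m}" for i
    proof (cases "i = Suc j")
      case True
      then have "segment' i = (Tick # tr) @ [Visit (mem s1)]" by (simp add: segment'_def)
      moreover have "set (Tick # tr) \<subseteq> {Tick}" "I i s1" using 1 True by auto
      moreover have "length ((Tick # tr) @ [Visit (mem s1)]) \<le> cost c + 2" using 1 by simp
      ultimately show ?thesis by metis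
    next
      case False
      then show ?thesis using 2(2) that by (simp add: segment'_def)
    qed
    ultimately show ?case by blast
  qed
  from this[of 0 s] init show ?thesis by simp
qed

section \<open>The program\<close>

text \<open>
  Registers: 0 is \<open>k\<close>, 1 counts the flawed steps, 2 and 3 hold 0 and 1, 4 holds \<open>2 k\<close>, 5 is the
  current position, 6 and 9 are the heights before and after the current step 8, 7 is the number of
  excursions left of the boundary that are still to come, 11 is the boundary, 12 points to the
  top of the stack, 13 is the parity of 5; the others are auxiliary.

  Memory: the path in \<open>0, \<dots>, 2 k - 1\<close>, then the matching of the invariant path, the table of
  \<open>neighbour\<close>, and the stack of unmatched up-steps, starting at \<open>2 k\<close>, \<open>4 k\<close> and \<open>6 k\<close>.
\<close>

fun seq :: "com list \<Rightarrow> com" where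
  "seq [] = Skip"
| "seq [c] = c"
| "seq (c # cs) = Seq c (seq cs)"

definition count_body :: com where
  "count_body = seq [Do (Load 8 5), Do (Add 9 6 8),
     If 6 2 Skip (If 9 2 (Do (Add 7 7 3)) Skip),
     Do (Add 6 9 2), Do (Add 5 5 3)]"

definition convert :: com where
  "convert = seq [Do (Load 8 5), Do (Add 9 6 8),
     If 2 7 (If 9 3 (Do (Sub 8 2 8)) Skip) (If 6 2 (Do (Sub 8 2 8)) Skip)]"

definition push :: com where
  "push = seq [Do (Store 12 5), Do (Add 12 12 3)]"

definition pop :: com where
  "pop = seq [Do (Sub 12 12 3), Do (Load 14 12),
     Do (Add 15 4 14), Do (Store 15 5), Do (Add 16 4 5), Do (Store 16 14),
     Do (Add 15 15 4), Do (Add 16 16 4),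
     If 2 13 (seq [Do (Sub 17 5 3), Do (Add 18 5 3)]) (seq [Do (Sub 17 14 3), Do (Add 18 14 3)]),
     Do (Store 16 17), Do (Store 15 18)]"

definition advance :: com where
  "advance = seq [Do (Sub 13 3 13),
     If 2 7 (If 9 2 Skip (If 2 9 Skip (seq [Do (Sub 7 7 3), Do (Add 11 5 3)]))) Skip,
     Do (Add 6 9 2), Do (Add 5 5 3)]"

definition match_body :: com where
  "match_body = seq [convert, If 2 8 push pop, advance]"

definition goto_right_end :: com where
  "goto_right_end = seq [Do (Add 15 11 4), Do (Load 16 15), If 11 16 (Do (Add 11 16 2)) Skip]"

definition goto_left_end :: com where
  "goto_left_end = seq [Do (Add 15 11 4), Do (Load 16 15), If 16 11 (Do (Add 11 16 2)) Skip]"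

definition goto_neighbour :: com where
  "goto_neighbour = seq [Do (Add 15 11 4), Do (Add 15 15 4), Do (Load 11 15)]"

definition flip_body :: com where
  "flip_body = seq [Do (Add 1 1 3), goto_right_end, Do (Store 11 3), goto_neighbour,
     goto_left_end, Do (Sub 16 2 3), Do (Store 11 16), goto_neighbour]"

definition startup :: com where
  "startup = seq [Do (Const 3 1), Do (Add 4 0 0)]"

definition reset :: com where
  "reset = seq [Do (Const 5 0), Do (Const 6 0), Do (Add 12 4 4), Do (Add 12 12 4)]"

definition preprocess :: com where
  "preprocess = Seq startup (Seq (While 5 4 count_body) (Seq reset (While 5 4 match_body)))"

definition program :: com where
  "program = Seq preprocess (While 1 0 (Seq flip_body (Do Emit)))"

lemma wp_mono: "wp N c Q s \<Longrightarrow> (\<And>s'. Q s' \<Longrightarrow> R s') \<Longrightarrow> wp N c R s"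
proof (induction c arbitrary: Q R s)
  case (Do i)
  then show ?case by (cases i) auto
next
  case (Seq c1 c2)
  have "wp N c2 R s'" if "wp N c2 Q s'" for s'
    using Seq.IH(2)[OF that Seq.prems(2)] .
  then show ?case using Seq.IH(1)[of "wp N c2 Q" s "wp N c2 R"] Seq.prems(1) by simp
next
  case (If a b c1 c2)
  then show ?case by (auto split: if_splits)
qed auto

lemma even_height: "i \<le> length x \<Longrightarrow> even (height x i + int i)"
proof (induction i)
  case (Suc i)
  then show ?case using rise_cases[of "x ! i"] by (auto simp: height_Suc)
qed simp

lemma card_less_Suc:
  "card {i. i < Suc n \<and> P i} = card {i. i < n \<and> P i} + (if P n then 1 else 0)"
proof -
  have "{i. i < Suc n \<and> P i} = {i. i < n \<and> P i} \<union> (if P n then {n} else {})"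
    by (auto simp: less_Suc_eq)
  then show ?thesis by (auto simp: card_insert_if)
qed

lemma card_le_bound: "card {i. i < (n :: nat) \<and> P i} \<le> n"
  using card_mono[of "{..<n}" "{i. i < n \<and> P i}"] by auto

section \<open>Invariants of the two scans\<close>

definition entry :: "nat \<Rightarrow> (nat \<Rightarrow> int) \<Rightarrow> nat \<Rightarrow> nat \<Rightarrow> bool" where
  "entry k m i j \<longleftrightarrow> m (2 * k + i) = int j \<and> m (2 * k + j) = int i \<and>
    m (4 * k + i) = int (fst (turn i j)) \<and> m (4 * k + j) = int (snd (turn i j))"

text \<open>The brackets still open before step \<open>t\<close>. Their starting heights are
  distinct, so each is kept in the stack slot of its own height.\<close>

definition pending :: "path \<Rightarrow> nat \<Rightarrow> nat \<Rightarrow> bool" where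
  "pending w t i \<longleftrightarrow> i < t \<and> w ! i = Up \<and> (\<forall>l. i < l \<and> l \<le> t \<longrightarrow> height w i < height w l)"

text \<open>Path, two tables and stack fit into \<open>8 * k\<close> cells; \<open>10 * k\<close>
  also covers all intermediate values.\<close>

locale run =
  fixes N k e :: nat and x w :: path and as bs :: "block list"
  assumes k: "1 \<le> k" and N: "10 * k \<le> N" and len: "length x = 2 * k"
    and lay: "layout as bs x w" and e: "e < k" "below_length (as @ bs) = 2 * e"
begin

abbreviation "a \<equiv> length (blks as)"

definition base :: "state \<Rightarrow> bool" where
  "base s \<longleftrightarrow> regs s 0 = int k \<and> regs s 1 = int e \<and> regs s 2 = 0 \<and> regs s 3 = 1 \<and>
    regs s 4 = 2 * int k \<and> stores_path (mem s) x"

lemma Ni: "10 * int k \<le> int N"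
  using N by linarith

lemma len_w: "length w = 2 * k"
  using layout_length[OF lay] len by simp

lemma a_le: "a \<le> 2 * k"
  using lay len by (simp add: layout_def)

lemma height_a: "height x a = 0"
  using lay by (simp add: layout_def height_append_length)

lemma height_x_bound: "i \<le> 2 * k \<Longrightarrow> \<bar>height x i\<bar> \<le> 2 * int k"
  using abs_height[of x i] by linarith

lemma height_w_bound: "i \<le> 2 * k \<Longrightarrow> 0 \<le> height w i \<and> height w i \<le> int i"
  using abs_height[of w i] dyck_height_nonneg[OF layout_dyck[OF lay], of i] len_w by auto

text \<open>Registers 11 and 13 stay 0 for the second scan: 0 is already the right boundary if A is
  empty.\<close>

definition count_inv :: "nat \<Rightarrow> state \<Rightarrow> bool" where
  "count_inv t s \<longleftrightarrow> base s \<and> t \<le> 2 * k \<and> regs s 5 = int t \<and> regs s 6 = height x t \<and>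
    regs s 7 = int (card {i. i < t \<and> x ! i = Down \<and> height x i = 0}) \<and> regs s 11 = 0 \<and> regs s 13 = 0"

lemma count_step:
  assumes "t < 2 * k" "count_inv t s"
  shows "regs s 5 < regs s 4 \<and> wp N count_body (count_inv (Suc t)) s"
proof -
  have m: "mem s t = rise (x ! t)" using assms len by (auto simp: count_inv_def base_def stores_path_def)
  have h: "height x (Suc t) = height x t + rise (x ! t)" using assms(1) len by (simp add: height_Suc)
  have b: "height x t \<le> 2 * int k" "- height x t \<le> 2 * int k"
    "height x (Suc t) \<le> 2 * int k" "- height x (Suc t) \<le> 2 * int k"
    using assms(1) height_x_bound[of t] height_x_bound[of "Suc t"] by simp_all
  have c: "int (card {i. i < t \<and> x ! i = Down \<and> height x i = 0}) \<le> int t"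
    using card_le_bound[of t "\<lambda>i. x ! i = Down \<and> height x i = 0"] by simp
  note cs = card_less_Suc[of t "\<lambda>i. x ! i = Down \<and> height x i = 0"]
  show ?thesis
    using assms k Ni m h b c rise_cases[of "x ! t"]
    by (cases "x ! t") (simp_all add: count_inv_def base_def count_body_def valid_address_def cs del: One_nat_def)
qed

definition returns_left :: "nat \<Rightarrow> nat" where
  "returns_left t = card {i. t \<le> i \<and> i < a \<and> height x (Suc i) = 0}"

lemma returns_left_Suc:
  "t < a \<Longrightarrow> returns_left t = returns_left (Suc t) + (if height x (Suc t) = 0 then 1 else 0)"
proof -
  assume "t < a"
  then have "{i. t \<le> i \<and> i < a \<and> height x (Suc i) = 0} =
      {i. Suc t \<le> i \<and> i < a \<and> height x (Suc i) = 0} \<union> (if height x (Suc t) = 0 then {t} else {})"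
    by (auto simp: Suc_le_eq dest: le_neq_implies_less)
  then show ?thesis by (auto simp: returns_left_def card_insert_if)
qed

text \<open>The last step before the boundary is itself a return, so register 7 is positive exactly
  while the scan is in A. \<open>convert\<close> branches on this.\<close>

lemma returns_left_pos: "0 < returns_left t \<longleftrightarrow> t < a"
proof
  assume "t < a"
  define l where "l = a - 1"
  have l: "Suc l = a" using \<open>t < a\<close> by (simp add: l_def)
  have "l \<in> {i. t \<le> i \<and> i < a \<and> height x (Suc i) = 0}"
    unfolding mem_Collect_eq l using height_a l \<open>t < a\<close> by linarith
  then show "0 < returns_left t" unfolding returns_left_def by (subst card_gt_0_iff) auto
next
  assume "0 < returns_left t"
  then show "t < a" unfolding returns_left_def by (subst (asm) card_gt_0_iff) auto
qed

lemma returns_left_le: "returns_left t \<le> 2 * k"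
proof -
  have "returns_left t \<le> card {..<a}" unfolding returns_left_def by (rule card_mono) auto
  then show ?thesis using a_le by simp
qed

text \<open>The down-steps from height 0 counted by the first scan are as many as the returns in A
  that the second scan counts down.\<close>

lemma returns_left_0: "returns_left 0 = card {i. i < 2 * k \<and> x ! i = Down \<and> height x i = 0}"
  using card_returns[OF lay] layout_d[OF lay] len by (simp add: returns_left_def d_def)

definition tables :: "(nat \<Rightarrow> int) \<Rightarrow> nat \<Rightarrow> bool" where
  "tables m t \<longleftrightarrow> (\<forall>i j. matched w i j \<and> j < t \<longrightarrow> entry k m i j)"

text \<open>Register 11 is overwritten at each return in A, so it is the boundary only from
  \<open>t = a\<close> on.\<close>

definition scan :: "nat \<Rightarrow> state \<Rightarrow> bool" where
  "scan t s \<longleftrightarrow> base s \<and> t \<le> 2 * k \<and> regs s 5 = int t \<and> regs s 7 = int (returns_left t) \<and>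
    (a \<le> t \<longrightarrow> regs s 11 = int a) \<and> regs s 6 = height x t \<and> regs s 13 = int (t mod 2)"

definition stack :: "nat \<Rightarrow> state \<Rightarrow> bool" where
  "stack t s \<longleftrightarrow> regs s 12 = 6 * int k + height w t \<and> tables (mem s) t \<and>
    (\<forall>i. pending w t i \<longrightarrow> mem s (6 * k + nat (height w i)) = int i)"

lemma convert_step:
  assumes "t < 2 * k" "scan t s"
    and Q: "\<And>s'. \<forall>r. r \<notin> {8, 9} \<longrightarrow> regs s' r = regs s r \<Longrightarrow> mem s' = mem s \<Longrightarrow>
      regs s' 8 = rise (w ! t) \<Longrightarrow> regs s' 9 = height x (Suc t) \<Longrightarrow> Q s'"
  shows "wp N convert Q s"
proof -
  have m: "mem s t = rise (x ! t)" using assms len by (auto simp: scan_def base_def stores_path_def)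
  have h: "height x (Suc t) = height x t + rise (x ! t)" using assms(1) len by (simp add: height_Suc)
  have b: "\<bar>height x t\<bar> \<le> 2 * int k" "\<bar>height x (Suc t)\<bar> \<le> 2 * int k"
    using assms(1) height_x_bound[of t] height_x_bound[of "Suc t"] by simp_all
  \<comment> \<open>\<open>height x (Suc t) < 1\<close> replaces \<open>\<le> 0\<close> because the
    machine tests only \<open><\<close>.\<close>
  have w: "rise (w ! t) = (if (if t < a then height x (Suc t) < 1 else height x t < 0)
    then - rise (x ! t) else rise (x ! t))"
    using layout_nth[OF lay, of t] assms(1) len by auto
  have p: "0 < int (returns_left t) \<longleftrightarrow> t < a" using returns_left_pos by simp
  show ?thesis
    unfolding convert_def
    by (rule wp_mono[where Q = "\<lambda>s'. (\<forall>r. r \<notin> {8, 9} \<longrightarrow> regs s' r = regs s r) \<and> mem s' = mem s \<and>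
        regs s' 8 = rise (w ! t) \<and> regs s' 9 = height x (Suc t)"])
      (use assms(1,2) k Ni m b w p rise_cases[of "x ! t"] in
        \<open>simp_all add: scan_def base_def valid_address_def h Q del: One_nat_def\<close>)
qed

lemma advance_step:
  assumes "t < 2 * k" "scan t s" "stack (Suc t) s'" "stores_path (mem s') x"
    "\<forall>r. r \<notin> {8, 9, 12, 14, 15, 16, 17, 18} \<longrightarrow> regs s' r = regs s r"
    "regs s' 9 = height x (Suc t)"
  shows "wp N advance (\<lambda>s. scan (Suc t) s \<and> stack (Suc t) s) s'"
proof -
  have h: "\<bar>height x (Suc t)\<bar> \<le> 2 * int k" using assms(1) height_x_bound[of "Suc t"] by simp
  have p: "0 < returns_left t \<longleftrightarrow> t < a" by (rule returns_left_pos)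
  have n: "int (returns_left t) \<le> 2 * int k" using returns_left_le[of t] by simp
  have r: "returns_left (Suc t) = 0" if "\<not> t < a" using that returns_left_pos[of "Suc t"] by simp
  have z: "a \<noteq> Suc t" if "height x (Suc t) \<noteq> 0" using that height_a by metis
  have par: "int (Suc t mod 2) = 1 - int (t mod 2)" by presburger
  have par': "0 \<le> int (t mod 2)" "int (t mod 2) \<le> 1" by presburger+
  show ?thesis
    unfolding advance_def
    using assms k Ni h p n r z par par' returns_left_Suc[of t]
    by (auto simp: scan_def stack_def base_def valid_address_def simp del: One_nat_def)
qed

lemma push_step:
  assumes "t < 2 * k" "w ! t = Up" "base s" "regs s 5 = int t" "stack t s"
    and Q: "\<And>s'. \<forall>r. r \<noteq> 12 \<longrightarrow> regs s' r = regs s r \<Longrightarrow> stack (Suc t) s' \<Longrightarrow>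
      stores_path (mem s') x \<Longrightarrow> Q s'"
  shows "wp N push Q s"
proof -
  have h: "height w (Suc t) = height w t + 1" using assms(1,2) len_w by (simp add: height_Suc)
  have b: "0 \<le> height w t" "height w t \<le> 2 * int k"
    using height_w_bound[of t] assms(1) by linarith+
  define m where "m = (mem s)(6 * k + nat (height w t) := int t)"
  have "tables m (Suc t)"
    unfolding tables_def
  proof (intro allI impI)
    fix i j
    assume ij: "matched w i j \<and> j < Suc t"
    then have "j \<noteq> t" using assms(2) by (auto simp: matched_def)
    then have "j < t" "i < j" using ij by (auto simp: matched_def)
    then show "entry k m i j"
      using ij assms(1,5) unfolding m_def entry_def stack_def tables_def by simp
  qed
  \<comment> \<open>Older open brackets start strictly lower, so the new entry overwrites none of
    them.\<close>
  moreover have "m (6 * k + nat (height w i)) = int i" if i: "pending w (Suc t) i" for i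
  proof (cases "i = t")
    case False
    then have "pending w t i" "height w i < height w t" "i < t"
      using i by (auto simp: pending_def)
    moreover have "0 \<le> height w i" using height_w_bound[of i] \<open>i < t\<close> assms(1) by simp
    ultimately show ?thesis using assms(5) by (simp add: m_def stack_def)
  qed (simp add: m_def)
  moreover have "stores_path m x"
    using assms(3) len by (simp add: m_def base_def stores_path_def)
  moreover have "nat (6 * int k + height w t) = 6 * k + nat (height w t)"
    using b by linarith
  moreover have "regs s 12 = 6 * int k + height w t" using assms(5) by (simp add: stack_def)
  ultimately show ?thesis
    unfolding push_def
    using assms(3,4) k Ni b h
    by (simp add: base_def valid_address_def Q stack_def m_def del: One_nat_def)
qed

lemma pop_step:
  assumes "t < 2 * k" "w ! t = Down" "base s" "regs s 5 = int t" "stack t s"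
    "regs s 13 = int (t mod 2)"
    and Q: "\<And>s'. \<forall>r. r \<notin> {12, 14, 15, 16, 17, 18} \<longrightarrow> regs s' r = regs s r \<Longrightarrow> stack (Suc t) s' \<Longrightarrow>
      stores_path (mem s') x \<Longrightarrow> Q s'"
  shows "wp N pop Q s"
proof -
  have h: "height w (Suc t) = height w t - 1" using assms(1,2) len_w by (simp add: height_Suc)
  have b: "0 \<le> height w t - 1" "height w t \<le> 2 * int k"
    using height_w_bound[of t] height_w_bound[of "Suc t"] assms(1) h by linarith+
  obtain i where i: "matched w i t"
    using dyck_matched[OF layout_dyck[OF lay], of t] assms(1,2) len_w by auto
  have it: "i < t" "height w i = height w t - 1" using i h by (auto simp: matched_def)
  \<comment> \<open>The partner is an open bracket at height \<open>height w t - 1\<close>, which is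
    the top slot of the stack.\<close>
  have "pending w t i" using i by (auto simp: pending_def matched_def)
  then have top: "mem s (6 * k + nat (height w t - 1)) = int i"
    using assms(5) it by (auto simp: stack_def dest: spec[of _ i])
  define m where "m = (mem s)(2 * k + i := int t, 2 * k + t := int i,
    4 * k + t := int (snd (turn i t)), 4 * k + i := int (fst (turn i t)))"
  have tab: "tables m (Suc t)"
    unfolding tables_def
  proof (intro allI impI)
    fix i' j
    assume ij: "matched w i' j \<and> j < Suc t"
    show "entry k m i' j"
    proof (cases "j = t")
      case True
      have "i' = i"
      proof (rule ccontr)
        assume "i' \<noteq> i"
        then consider "i' < i" | "i < i'" by linarith
        then show False using ij True i by cases (force simp: matched_def)+
      qed
      then show ?thesis using True it assms(1) by (simp add: entry_def m_def del: turn.simps)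
    next
      case False
      then have "j < t" "i' < j" using ij by (auto simp: matched_def)
      \<comment> \<open>No earlier pair begins at \<open>i\<close>: the path stays above
        \<open>height w i\<close> up to \<open>t\<close>.\<close>
      moreover have "i' \<noteq> i"
      proof
        assume "i' = i"
        have "\<forall>l. i < l \<and> l \<le> t \<longrightarrow> height w i < height w l"
          using i unfolding matched_def by blast
        then have "height w i < height w (Suc j)" using \<open>j < t\<close> \<open>i' < j\<close> \<open>i' = i\<close> by auto
        then show False using ij \<open>i' = i\<close> by (simp add: matched_def)
      qed
      moreover have "j \<noteq> i" using ij i by (auto simp: matched_def)
      moreover have "entry k (mem s) i' j" using ij \<open>j < t\<close> assms(5) by (simp add: stack_def tables_def)
      ultimately show ?thesis using it assms(1) by (simp add: entry_def m_def del: turn.simps)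
    qed
  qed
  have st: "m (6 * k + nat (height w l)) = int l" if l: "pending w (Suc t) l" for l
  proof -
    have "l \<noteq> t" using l assms(2) by (auto simp: pending_def)
    then have "pending w t l" using l by (auto simp: pending_def)
    then show ?thesis using assms(1,5) it by (simp add: m_def stack_def)
  qed
  have sp: "stores_path m x"
    using assms(3) len by (simp add: m_def base_def stores_path_def)
  have "nat (6 * int k + height w t - 1) = 6 * k + nat (height w t - 1)"
    using b by linarith
  moreover have "nat (2 * int k + int l) = 2 * k + l" "nat (2 * int k + int l + 2 * int k) = 4 * k + l" for l
    by linarith+
  moreover have "regs s 12 = 6 * int k + height w t" using assms(5) by (simp add: stack_def)
  moreover have "int i < int t" "int t < 2 * int k" using it assms(1) by linarith+
  moreover have "0 < int (t mod 2) \<Longrightarrow> int (fst (turn i t)) = int t + 1 \<and> int (snd (turn i t)) = int t - 1"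
    "\<not> 0 < int (t mod 2) \<Longrightarrow> int (fst (turn i t)) = int i + 1 \<and> int (snd (turn i t)) = int i - 1"
  proof -
    \<comment> \<open>Partners have opposite parity. For even \<open>t\<close> the position
      \<open>i\<close> is odd, so \<open>i - 1\<close> is not truncated and the register arithmetic
      agrees with \<open>turn\<close>.\<close>
    have "even (height w i + int i)" "even (height w (Suc t) + int (Suc t))"
      using even_height[of i w] even_height[of "Suc t" w] it assms(1) len_w by auto
    then have "even t \<Longrightarrow> odd i" using it h by (auto simp: even_diff_iff)
    then show "0 < int (t mod 2) \<Longrightarrow> int (fst (turn i t)) = int t + 1 \<and> int (snd (turn i t)) = int t - 1"
      "\<not> 0 < int (t mod 2) \<Longrightarrow> int (fst (turn i t)) = int i + 1 \<and> int (snd (turn i t)) = int i - 1"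
      using it by (auto simp: odd_iff_mod_2_eq_one elim: oddE)
  qed
  ultimately have "wp N pop (\<lambda>s'. (\<forall>r. r \<notin> {12, 14, 15, 16, 17, 18} \<longrightarrow> regs s' r = regs s r) \<and>
      regs s' 12 = 6 * int k + height w (Suc t) \<and> mem s' = m) s"
    unfolding pop_def
    using assms(3,4,6) k Ni b h top
    by (cases "0 < int (t mod 2)")
      (simp_all add: base_def valid_address_def m_def del: One_nat_def turn.simps)
  then show ?thesis
    by (rule wp_mono) (use tab st sp in \<open>auto simp: stack_def intro!: Q\<close>)
qed

lemma match_step:
  assumes "t < 2 * k" "scan t s \<and> stack t s"
  shows "regs s 5 < regs s 4 \<and> wp N match_body (\<lambda>s. scan (Suc t) s \<and> stack (Suc t) s) s"
proof
  show "regs s 5 < regs s 4" using assms by (simp add: scan_def base_def)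
  have "wp N (If 2 8 push pop) (wp N advance (\<lambda>s. scan (Suc t) s \<and> stack (Suc t) s)) s1"
    if s1: "\<forall>r. r \<notin> {8, 9} \<longrightarrow> regs s1 r = regs s r" "mem s1 = mem s"
      "regs s1 8 = rise (w ! t)" "regs s1 9 = height x (Suc t)" for s1
  proof -
    have 1: "base s1" "regs s1 5 = int t" "stack t s1" "regs s1 13 = int (t mod 2)" "regs s1 2 = 0"
      using assms(2) s1 by (auto simp: scan_def stack_def base_def)
    have "wp N push (wp N advance (\<lambda>s. scan (Suc t) s \<and> stack (Suc t) s)) s1" if "w ! t = Up"
      by (rule push_step[OF assms(1) that 1(1,2,3)]) (rule advance_step, use assms s1 in auto)
    moreover have "wp N pop (wp N advance (\<lambda>s. scan (Suc t) s \<and> stack (Suc t) s)) s1" if "w ! t = Down"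
      by (rule pop_step[OF assms(1) that 1(1,2,3,4)]) (rule advance_step, use assms s1 in auto)
    ultimately show ?thesis
      using 1(5) s1(3) by (cases "w ! t") simp_all
  qed
  then show "wp N match_body (\<lambda>s. scan (Suc t) s \<and> stack (Suc t) s) s"
    unfolding match_body_def using assms by (auto intro!: convert_step)
qed

lemma tables_lookup:
  assumes "tables m (2 * k)" "matched w i j"
  shows "m (2 * k + i) = int j" "m (2 * k + j) = int i" "m (4 * k + i) = int (fst (turn i j))"
    "m (4 * k + j) = int (snd (turn i j))" "i < j" "j < 2 * k"
  using assms len_w by (auto simp: tables_def entry_def matched_def simp del: turn.simps)

section \<open>Constant-time moves through the tables\<close>

definition walk :: "state \<Rightarrow> bool" where
  "walk s \<longleftrightarrow> regs s 2 = 0 \<and> regs s 3 = 1 \<and> regs s 4 = 2 * int k \<and> tables (mem s) (2 * k)"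

text \<open>Flips write only to path cells, below \<open>2 * k\<close>, so the tables
  survive.\<close>

lemma walk_cong:
  assumes "walk s" "regs s' 2 = regs s 2" "regs s' 3 = regs s 3" "regs s' 4 = regs s 4"
    "\<And>l. 2 * k \<le> l \<Longrightarrow> mem s' l = mem s l"
  shows "walk s'"
  using assms by (auto simp: walk_def tables_def entry_def)

lemma nat_addr: "nat (int q + 2 * int k) = 2 * k + q" "nat (4 * int k + int q) = 4 * k + q"
  by linarith+

text \<open>The value \<open>2 * k\<close> is the boundary once B is empty, and then the loop
  stops.\<close>

lemma entry_shape: "matched w i j \<Longrightarrow> fst (turn i j) \<le> 2 * k \<and> snd (turn i j) < 2 * k"
  by (auto simp: matched_def len_w)

lemma goto_right_end_step:
  assumes "walk s" "regs s 11 = int q" "right_end w q p"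
    and Q: "\<And>s'. \<forall>r. r \<notin> {11, 15, 16} \<longrightarrow> regs s' r = regs s r \<Longrightarrow> mem s' = mem s \<Longrightarrow>
      regs s' 11 = int p \<Longrightarrow> p < 2 * k \<Longrightarrow> Q s'"
  shows "wp N goto_right_end Q s"
proof -
  obtain l where l: "mem s (2 * k + q) = int l" "q < 2 * k" "l < 2 * k" "p = max q l"
    using assms(3) unfolding right_end_def
  proof (elim disjE exE conjE)
    assume "matched w q p"
    then show thesis using that[of p] tables_lookup[of "mem s" q p] assms(1) by (auto simp: walk_def)
  next
    fix i
    assume "matched w i q" "p = q"
    then show thesis using that[of i] tables_lookup[of "mem s" i q] assms(1) by (auto simp: walk_def)
  qed
  then have "p < 2 * k" by simp
  then show ?thesis
    using assms(1,2) l k Ni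
    by (auto simp: goto_right_end_def walk_def valid_address_def nat_addr max_def simp del: One_nat_def split: if_splits intro!: Q)
qed

lemma goto_left_end_step:
  assumes "walk s" "regs s 11 = int q" "left_end w q p"
    and Q: "\<And>s'. \<forall>r. r \<notin> {11, 15, 16} \<longrightarrow> regs s' r = regs s r \<Longrightarrow> mem s' = mem s \<Longrightarrow>
      regs s' 11 = int p \<Longrightarrow> p < 2 * k \<Longrightarrow> Q s'"
  shows "wp N goto_left_end Q s"
proof -
  obtain l where l: "mem s (2 * k + q) = int l" "q < 2 * k" "l < 2 * k" "p = min q l"
    using assms(3) unfolding left_end_def
  proof (elim disjE exE conjE)
    assume "matched w p q"
    then show thesis using that[of p] tables_lookup[of "mem s" p q] assms(1) by (auto simp: walk_def)
  next
    fix j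
    assume "matched w q j" "p = q"
    then show thesis using that[of j] tables_lookup[of "mem s" q j] assms(1) by (auto simp: walk_def)
  qed
  then have "p < 2 * k" by simp
  then show ?thesis
    using assms(1,2) l k Ni
    by (auto simp: goto_left_end_def walk_def valid_address_def nat_addr min_def simp del: One_nat_def split: if_splits intro!: Q)
qed

lemma goto_neighbour_step:
  assumes "walk s" "regs s 11 = int q" "neighbour w q p"
    and Q: "\<And>s'. \<forall>r. r \<notin> {11, 15} \<longrightarrow> regs s' r = regs s r \<Longrightarrow> mem s' = mem s \<Longrightarrow>
      regs s' 11 = int p \<Longrightarrow> Q s'"
  shows "wp N goto_neighbour Q s"
proof -
  from assms(3) have l: "mem s (4 * k + q) = int p \<and> q < 2 * k \<and> p \<le> 2 * k"
  proof (unfold neighbour_def, elim disjE exE conjE)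
    fix j assume "matched w q j" "p = fst (turn q j)"
    then show ?thesis
      using tables_lookup[of "mem s" q j] assms(1) entry_shape[of q j] by (auto simp: walk_def simp del: turn.simps)
  next
    fix i assume "matched w i q" "p = snd (turn i q)"
    then show ?thesis
      using tables_lookup[of "mem s" i q] assms(1) entry_shape[of i q] by (auto simp: walk_def simp del: turn.simps)
  qed
  then show ?thesis
    using assms(1,2) k Ni
    by (auto simp: goto_neighbour_def walk_def valid_address_def nat_addr simp del: One_nat_def split: if_splits intro!: Q)
qed

definition visit_inv :: "nat \<Rightarrow> state \<Rightarrow> bool" where
  "visit_inv i s \<longleftrightarrow> (\<exists>as bs. layout as bs ((f ^^ i) x) w \<and> below_length (as @ bs) = 2 * (e + i) \<and>
    regs s 11 = int (length (blks as))) \<and>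
    regs s 0 = int k \<and> regs s 1 = int (e + i) \<and> walk s \<and> stores_path (mem s) ((f ^^ i) x)"

lemma visit_step:
  assumes "i < k - e" "visit_inv i s"
  shows "regs s 1 < regs s 0 \<and> wp N flip_body (visit_inv (Suc i)) s"
proof
  show "regs s 1 < regs s 0" using assms by (simp add: visit_inv_def)
  let ?y = "(f ^^ i) x"
  obtain as bs where y: "layout as bs ?y w" "below_length (as @ bs) = 2 * (e + i)"
    "regs s 11 = int (length (blks as))"
    using assms(2) by (auto simp: visit_inv_def)
  \<comment> \<open>If B were empty, A would have no positive excursion; all \<open>2 * k\<close>
    steps would lie below, forcing \<open>e + i = k\<close>.\<close>
  have "bs \<noteq> []"
  proof
    assume "bs = []"
    then have "npos as = 0" "length (blks as) = 2 * k"
      using y(1) len_w by (auto simp: layout_def)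
    moreover have "npos as = 0 \<Longrightarrow> below_length as = length (blks as)"
      by (induction as) (auto split: if_splits)
    ultimately show False using y(2) \<open>bs = []\<close> assms(1) by simp
  qed
  then obtain as' bs' p p' q where st: "layout as' bs' (f ?y) w"
    "below_length (as' @ bs') = below_length (as @ bs) + 2" "f ?y = ?y[p := Up, p' := Down]"
    "right_end w (length (blks as)) p" "neighbour w p q" "left_end w q p'"
    "neighbour w p' (length (blks as'))"
    using layout_step[OF y(1)] by metis
  have s: "regs s 0 = int k" "regs s 1 = int (e + i)" "walk s" "stores_path (mem s) ?y"
    using assms(2) by (auto simp: visit_inv_def)
  have len_y: "length ?y = 2 * k" using layout_length[OF y(1)] len_w by simp
  have w: "regs s 2 = 0" "regs s 3 = 1" using s(3) by (auto simp: walk_def)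
  define s0 where "s0 = s\<lparr>regs := (regs s)(1 := int (e + i) + 1)\<rparr>"
  have "walk s0" by (rule walk_cong[OF s(3)]) (auto simp: s0_def)
  have "wp N (seq [goto_right_end, Do (Store 11 3), goto_neighbour,
     goto_left_end, Do (Sub 16 2 3), Do (Store 11 16), goto_neighbour]) (visit_inv (Suc i)) s0"
    unfolding seq.simps wp.simps
  proof (rule goto_right_end_step[OF \<open>walk s0\<close> _ st(4)])
    show "regs s0 11 = int (length (blks as))" using y by (simp add: s0_def)
    fix s1 :: state
    assume s1: "\<forall>r. r \<notin> {11, 15, 16} \<longrightarrow> regs s1 r = regs s0 r" "mem s1 = mem s0"
      "regs s1 11 = int p" "p < 2 * k"
    define s1' where "s1' = s1\<lparr>mem := (mem s)(p := 1)\<rparr>"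
    have r1: "\<forall>r. r \<notin> {11, 15, 16} \<longrightarrow> regs s1' r = regs s0 r" "regs s1' 11 = int p"
      using s1 by (simp_all add: s1'_def)
    have "walk s1'"
      by (rule walk_cong[OF \<open>walk s0\<close>]) (use s1 in \<open>auto simp: s1'_def s0_def\<close>)
    have "wp N goto_neighbour (wp N goto_left_end (exec_wp N (Sub 16 2 3)
        (exec_wp N (Store 11 16) (wp N goto_neighbour (visit_inv (Suc i)))))) s1'"
    proof (rule goto_neighbour_step[OF \<open>walk s1'\<close> r1(2) st(5)])
      fix s2 :: state
    assume s2: "\<forall>r. r \<notin> {11, 15} \<longrightarrow> regs s2 r = regs s1' r" "mem s2 = mem s1'" "regs s2 11 = int q"
      have "walk s2" by (rule walk_cong[OF \<open>walk s1'\<close>]) (use s2 in auto)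
      show "wp N goto_left_end (exec_wp N (Sub 16 2 3)
        (exec_wp N (Store 11 16) (wp N goto_neighbour (visit_inv (Suc i))))) s2"
      proof (rule goto_left_end_step[OF \<open>walk s2\<close> s2(3) st(6)])
        fix s3 :: state
    assume s3: "\<forall>r. r \<notin> {11, 15, 16} \<longrightarrow> regs s3 r = regs s2 r" "mem s3 = mem s2"
          "regs s3 11 = int p'" "p' < 2 * k"
        have r3: "\<forall>r. r \<notin> {11, 15, 16} \<longrightarrow> regs s3 r = regs s0 r" using s3 s2 r1 by auto
        have "regs s3 2 = 0" "regs s3 3 = 1" using r3 w by (auto simp: s0_def)
        define s3' where "s3' = s3\<lparr>regs := (regs s3)(16 := - 1), mem := (mem s)(p := 1, p' := - 1)\<rparr>"
        have r3': "\<forall>r. r \<notin> {11, 15, 16} \<longrightarrow> regs s3' r = regs s0 r" "regs s3' 11 = int p'"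
          using s3 r3 by (simp_all add: s3'_def)
        have "walk s3'"
          by (rule walk_cong[OF \<open>walk s0\<close>]) (use s1 s3 r3' in \<open>auto simp: s3'_def s0_def\<close>)
        have "wp N goto_neighbour (visit_inv (Suc i)) s3'"
        proof (rule goto_neighbour_step[OF \<open>walk s3'\<close> r3'(2) st(7)])
          fix s4 :: state
    assume s4: "\<forall>r. r \<notin> {11, 15} \<longrightarrow> regs s4 r = regs s3' r" "mem s4 = mem s3'"
            "regs s4 11 = int (length (blks as'))"
          have "walk s4" by (rule walk_cong[OF \<open>walk s3'\<close>]) (use s4 in auto)
          moreover have "regs s4 0 = int k" "regs s4 1 = int (e + Suc i)"
            using s4 r3' s by (auto simp: s0_def)
          moreover have "stores_path (mem s4) (f ?y)"
            using s(4) s1(4) s3(4) len_y by (auto simp: stores_path_def s4 s3'_def st(3) nth_list_update)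
          ultimately show "visit_inv (Suc i) s4"
            using st(1,2) y(2) s4(3) unfolding visit_inv_def by auto
        qed
        then show "exec_wp N (Sub 16 2 3) (exec_wp N (Store 11 16) (wp N goto_neighbour (visit_inv (Suc i)))) s3"
          using \<open>regs s3 2 = 0\<close> \<open>regs s3 3 = 1\<close> s3(2,3,4) s2(2) k Ni
          by (simp add: valid_address_def s3'_def s1'_def)
      qed
    qed
    then show "exec_wp N (Store 11 3) (wp N goto_neighbour (wp N goto_left_end (exec_wp N (Sub 16 2 3)
        (exec_wp N (Store 11 16) (wp N goto_neighbour (visit_inv (Suc i))))))) s1"
      using s1 w Ni by (simp add: valid_address_def s1'_def s0_def)
  qed
  then show "wp N flip_body (visit_inv (Suc i)) s"
    unfolding flip_body_def using w s(2) assms(1) Ni by (simp add: s0_def del: One_nat_def)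
qed

lemma preprocess_quiet:
  "quiet N preprocess (input_state k e x)
    (cost startup + ((2 * k * Suc (cost count_body) + 1) +
      (cost reset + (2 * k * Suc (cost match_body) + 1)))) (visit_inv 0)"
  unfolding preprocess_def
proof (rule quiet_Seq)
  show "quiet N startup (input_state k e x) (cost startup) (count_inv 0)"
    by (rule quiet_wp)
      (use k Ni len in \<open>simp add: startup_def input_state_def count_inv_def base_def stores_path_def del: One_nat_def\<close>)
  fix s assume "count_inv 0 s"
  then show "quiet N (Seq (While 5 4 count_body) (Seq reset (While 5 4 match_body))) s
    ((2 * k * Suc (cost count_body) + 1) + (cost reset + (2 * k * Suc (cost match_body) + 1))) (visit_inv 0)"
  proof (intro quiet_Seq)
    show "quiet N (While 5 4 count_body) s (2 * k * Suc (cost count_body) + 1) (count_inv (2 * k))"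
    proof (rule quiet_While)
      show "regs s 5 < regs s 4 \<and> wp N count_body (count_inv (Suc t)) s"
        if "t < 2 * k" "count_inv t s" for t s
        using that by (rule count_step)
    qed (use \<open>count_inv 0 s\<close> in \<open>auto simp: count_inv_def base_def\<close>)
    fix s1 :: state
    assume s1: "count_inv (2 * k) s1"
    show "quiet N reset s1 (cost reset) (\<lambda>s. scan 0 s \<and> stack 0 s)"
      by (rule quiet_wp) (use s1 k Ni in \<open>simp add: reset_def count_inv_def scan_def stack_def base_def
          tables_def pending_def returns_left_0 del: One_nat_def\<close>)
    fix s2 :: state
    assume s2: "scan 0 s2 \<and> stack 0 s2"
    have "quiet N (While 5 4 match_body) s2 (2 * k * Suc (cost match_body) + 1)
        (\<lambda>s. scan (2 * k) s \<and> stack (2 * k) s)"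
    proof (rule quiet_While)
      show "regs s 5 < regs s 4 \<and> wp N match_body (\<lambda>s. scan (Suc t) s \<and> stack (Suc t) s) s"
        if "t < 2 * k" "scan t s \<and> stack t s" for t s
        using that by (rule match_step)
    qed (use s2 in \<open>auto simp: scan_def base_def\<close>)
    moreover have "visit_inv 0 s" if "scan (2 * k) s \<and> stack (2 * k) s" for s
    proof -
      have "regs s 11 = int a" using that a_le by (simp add: scan_def)
      then have "\<exists>as bs. layout as bs x w \<and> below_length (as @ bs) = 2 * e \<and> regs s 11 = int (length (blks as))"
        using lay e(2) by blast
      with that show ?thesis by (simp add: visit_inv_def scan_def stack_def base_def walk_def)
    qed
    ultimately show "quiet N (While 5 4 match_body) s2 (2 * k * Suc (cost match_body) + 1) (visit_inv 0)"
      by (auto simp: quiet_def)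
  qed
qed

end

section \<open>Adding up the costs\<close>

lemma costs:
  "cost startup = 2" "cost count_body = 7" "cost reset = 4" "cost match_body = 27" "cost flip_body = 18"
  by (auto simp: startup_def count_body_def reset_def match_body_def convert_def push_def pop_def
      advance_def flip_body_def goto_right_end_def goto_neighbour_def goto_left_end_def)

lemma length_concat_map_le:
  "(\<And>i. i \<in> set is \<Longrightarrow> length (t i) \<le> c) \<Longrightarrow> length (concat (map t is)) \<le> c * length is"
  by (induction "is") (auto intro!: add_mono)

theorem theorem3:
  "\<exists>(P :: com) (C :: nat). \<forall>k \<ge> 1. \<forall>e \<in> {0..k - 1}. \<forall>x \<in> D k e.
     \<exists>tr s' initial segment final.
       exec (C * k) P (input_state k e x) tr s' \<and>
       length tr \<le> C * k \<and>
       tr = initial @ concat (map segment [1..<k - e + 1]) @ final \<and>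
       set initial \<subseteq> {Tick} \<and> set final \<subseteq> {Tick} \<and>
       (\<forall>i \<in> {1..k - e}.
          length (segment i) \<le> C \<and>
          (\<exists>ticks m. segment i = ticks @ [Visit m] \<and> set ticks \<subseteq> {Tick} \<and>
             stores_path m ((f ^^ i) x)))"
proof (rule exI[of _ program], rule exI[of _ 101], intro allI impI ballI)
  fix k e :: nat and x
  assume k: "1 \<le> k" and "e \<in> {0..k - 1}" and x: "x \<in> D k e"
  then have e: "e < k" by auto
  have len: "length x = 2 * k" and ups: "card {i. i < length x \<and> x ! i = Up} = k"
    and flaws: "length (pos sunken 0 x) = e"
    using x by (auto simp: D_def L_def simp flip: below_pos)
  have "net x = 0" using ups by (simp add: net_eq len)
  then obtain as bs w where lay: "layout as bs x w" by (rule layout_exists)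
  have "below_length (as @ bs) = 2 * e"
    using lay length_pos_sunken[of "as @ bs"] flaws by (simp add: layout_def)
  then interpret run "101 * k" k e x w as bs
    using k len lay e by unfold_locales auto
  \<comment> \<open>The scans take \<open>2 * k\<close> rounds of \<open>7 + 1\<close> and of
    \<open>27 + 1\<close>; the 8 is startup 2, reset 4 and two failing tests.\<close>
  obtain initial s1 where initial: "exec (101 * k) preprocess (input_state k e x) initial s1"
    "set initial \<subseteq> {Tick}" "length initial \<le> 72 * k + 8" "visit_inv 0 s1"
    using preprocess_quiet unfolding quiet_def costs by fastforce
  have exit: "\<not> regs s 1 < regs s 0" if "visit_inv (k - e) s" for s
    using that e by (simp add: visit_inv_def)
  obtain segment s2 where loop:
    "exec (101 * k) (While 1 0 (Seq flip_body (Do Emit))) s1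
      (concat (map segment [1..<k - e + 1]) @ [Tick]) s2"
    and segment: "\<forall>i \<in> {1..k - e}. length (segment i) \<le> 18 + 2 \<and>
      (\<exists>ticks s. segment i = ticks @ [Visit (mem s)] \<and> set ticks \<subseteq> {Tick} \<and> visit_inv i s)"
    using exec_While_Emit[OF visit_step exit initial(4)] unfolding costs Suc_eq_plus1 by blast
  let ?tr = "initial @ concat (map segment [1..<k - e + 1]) @ [Tick]"
  have "length (concat (map segment [1..<k - e + 1])) \<le> 20 * length [1..<k - e + 1]"
    by (rule length_concat_map_le) (use segment in auto)
  \<comment> \<open>Here \<open>101 = 72 + 8 + 20 + 1\<close>: preprocessing
    \<open>72 * k + 8\<close>, at most \<open>k\<close> segments of 20, one failing test, and
    \<open>1 \<le> k\<close>.\<close>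
  then have "length ?tr \<le> 101 * k" using initial(3) k unfolding length_append length_upt by simp
  moreover have "exec (101 * k) program (input_state k e x) ?tr s2"
    unfolding program_def by (rule exec.Seq[OF initial(1) loop])
  moreover have "length (segment i) \<le> 101 \<and>
      (\<exists>ticks m. segment i = ticks @ [Visit m] \<and> set ticks \<subseteq> {Tick} \<and> stores_path m ((f ^^ i) x))"
    if i: "i \<in> {1..k - e}" for i
  proof -
    obtain ticks s where "segment i = ticks @ [Visit (mem s)]" "set ticks \<subseteq> {Tick}" "visit_inv i s"
      "length (segment i) \<le> 18 + 2"
      using bspec[OF segment i] by blast
    then show ?thesis by (auto simp: visit_inv_def)
  qed
  moreover have "set [Tick] \<subseteq> {Tick}" by simp
  ultimately show "\<exists>tr s' initial segment final.
       exec (101 * k) program (input_state k e x) tr s' \<and>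
       length tr \<le> 101 * k \<and>
       tr = initial @ concat (map segment [1..<k - e + 1]) @ final \<and>
       set initial \<subseteq> {Tick} \<and> set final \<subseteq> {Tick} \<and>
       (\<forall>i \<in> {1..k - e}.
          length (segment i) \<le> 101 \<and>
          (\<exists>ticks m. segment i = ticks @ [Visit m] \<and> set ticks \<subseteq> {Tick} \<and>
             stores_path m ((f ^^ i) x)))"
    using initial(2) by blast
qed

end
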